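(* In the AMLI-cycle setting described in the context, assume that the two-grid method converges uniformly with convergence rate $\delta_{TG}$. Let $k\ge4$ be an integer, let $\frac12\le a\le\frac43$, and let $\widetilde p_k$ be the MA polynomial defined by $\widetilde p_0(\widetilde x)=1$, $\widetilde p_1(\widetilde x)=1-\widetilde x$ and $$\widetilde p_{j+1}(\widetilde x)=2(1-a\widetilde x)\widetilde p_j(\widetilde x)-(1-a\widetilde x)\widetilde p_{j-1}(\widetilde x),\quad j\ge1.$$ Let $\widetilde\nu\in(0,1)$ be such that $\widetilde p_k(\widetilde\nu)\ge0$, $\widetilde p_k$ is decreasing on $(0,\widetilde\nu]$, and $\widetilde p_k(\widetilde\nu)\ge\max_{\widetilde x\in[\widetilde\nu,1]}\widetilde p_k(\widetilde x)$. Set $L=2$ and $p_k(x)=\widetilde p_k(x/L)$. Then the AMLI operators $B_\ell$ defined with the polynomial $p=p_k$ satisfy $$\kappa(B_\ell A_\ell)\le\frac2\mu\quad\text{for all levels }\ell,$$ provided there exists $0<\mu\le\bar\mu:=\min\{L\widetilde\nu,\,1-\delta_{TG}\}$ satisfying $$\mu\le(1-\delta_{TG})\left[1-p_k(\mu)\right].$$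
   Context: AMLI-cycle setting. SPD means symmetric positive definite. Let $J\ge 2$ be the number of levels. For $\ell=1,\dots,J$ let $A_\ell\in\mathbb{R}^{n_\ell\times n_\ell}$ be SPD, and for $\ell=1,\dots,J-1$ let $P_\ell\in\mathbb{R}^{n_\ell\times n_{\ell+1}}$ (prolongation) be such that $A_{\ell+1}=P_\ell^TA_\ell P_\ell$. For $\ell=1,\dots,J-1$ let $M_\ell\in\mathbb{R}^{n_\ell\times n_\ell}$ be a nonsingular matrix (smoother) which is nonexpansive: $\|I-M_\ell A_\ell\|_{A_\ell}\le 1$, where $\|\cdot\|_{A_\ell}$ is the operator norm induced by the inner product $(u,v)_{A_\ell}=(A_\ell u,v)$. Put $\overline{M}_\ell:=M_\ell^T(M_\ell^{-1}+M_\ell^{-T}-A_\ell)M_\ell=M_\ell+M_\ell^T-M_\ell^TA_\ell M_\ell$. Given a polynomial $p$ with $p(0)=1$, the AMLI operators are defined recursively from the coarsest level by $B_J=\widehat B_J=A_J^{-1}$, and $$B_\ell=\overline M_\ell+(I-M_\ell^TA_\ell)P_\ell\widehat B_{\ell+1}P_\ell^T(I-A_\ell M_\ell),\quad \ell=J-1,\dots,1,$$ $$\widehat B_\ell=(I-p(B_\ell A_\ell))A_\ell^{-1},\quad \ell=2,\dots,J-1.$$ The two-grid operator on level $\ell\le J-1$ is $B^{TG}_\ell=\overline M_\ell+(I-M_\ell^TA_\ell)P_\ell A_{\ell+1}^{-1}P_\ell^T(I-A_\ell M_\ell)$. "The two-grid method converges uniformly with convergence rate $\delta_{TG}$" means that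 $\delta_{TG}\in[0,1)$ and, for all $\ell=1,\dots,J-1$, $\lambda_{\min}(B_\ell^{TG}A_\ell)\ge 1-\delta_{TG}$ and $\lambda_{\max}(B_\ell^{TG}A_\ell)\le 1$. $\kappa(B_\ell A_\ell)=\lambda_{\max}(B_\ell A_\ell)/\lambda_{\min}(B_\ell A_\ell)$; a bound $\kappa(B_\ell A_\ell)\le C$ means that all eigenvalues of $B_\ell A_\ell$ are positive and $\lambda_{\max}\le C\lambda_{\min}$. *)

theory Defs
  imports
    "HOL-Library.Extended_Real"
    "Jordan_Normal_Form.Gauss_Jordan_Elimination"
    "Jordan_Normal_Form.Spectral_Radius"
begin

abbreviation mat_inv :: "real mat \<Rightarrow> real mat" where
  "mat_inv X \<equiv> the (mat_inverse X)"

definition spd :: "nat \<Rightarrow> real mat \<Rightarrow> bool" where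
  "spd n X \<longleftrightarrow> X \<in> carrier_mat n n \<and> transpose_mat X = X \<and>
     (\<forall>v \<in> carrier_vec n. v \<noteq> 0\<^sub>v n \<longrightarrow> (X *\<^sub>v v) \<bullet> v > 0)"

definition energy_norm :: "real mat \<Rightarrow> real vec \<Rightarrow> real" where
  "energy_norm X v = sqrt ((X *\<^sub>v v) \<bullet> v)"

text \<open>The operator norm is taken in the extended reals, so that the supremum is meaningful
  without first establishing that the set of quotients is bounded above.\<close>

definition energy_opnorm :: "real mat \<Rightarrow> real mat \<Rightarrow> ereal" where
  "energy_opnorm X T =
     (SUP v \<in> carrier_vec (dim_row X) - {0\<^sub>v (dim_row X)}.
        ereal (energy_norm X (T *\<^sub>v v) / energy_norm X v))"

definition poly_of_mat :: "real poly \<Rightarrow> real mat \<Rightarrow> real mat" where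
  "poly_of_mat p X = mat (dim_row X) (dim_row X)
     (\<lambda>(i, j). \<Sum>k\<le>degree p. coeff p k * (X ^\<^sub>m k) $$ (i, j))"

text \<open>Extreme real eigenvalues. These functions are used for products of two symmetric
  matrices one of which is positive definite; such a product has real spectrum only.\<close>

definition lambda_min :: "real mat \<Rightarrow> real" where
  "lambda_min X = Min (spectrum X)"

definition lambda_max :: "real mat \<Rightarrow> real" where
  "lambda_max X = Max (spectrum X)"

text \<open>The bound \<open>\<kappa>(X) \<le> C\<close>. Positivity is required of all complex eigenvalues, so
  that the absence of nonreal eigenvalues is part of the claim.\<close>

definition kappa_le :: "real mat \<Rightarrow> real \<Rightarrow> bool" where
  "kappa_le X C \<longleftrightarrow>
     (\<forall>z. eigenvalue (map_mat complex_of_real X) z \<longrightarrow> z \<in> \<real> \<and> Re z > 0) \<and>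
     lambda_max X \<le> C * lambda_min X"

definition M_bar :: "real mat \<Rightarrow> real mat \<Rightarrow> real mat" where
  "M_bar X M = transpose_mat M * (mat_inv M + transpose_mat (mat_inv M) - X) * M"

definition two_level_op :: "real mat \<Rightarrow> real mat \<Rightarrow> real mat \<Rightarrow> real mat \<Rightarrow> real mat" where
  "two_level_op X M P C = M_bar X M +
     (1\<^sub>m (dim_row X) - transpose_mat M * X) * P * C * transpose_mat P *
     (1\<^sub>m (dim_row X) - X * M)"

definition two_grid_B ::
  "(nat \<Rightarrow> real mat) \<Rightarrow> (nat \<Rightarrow> real mat) \<Rightarrow> (nat \<Rightarrow> real mat) \<Rightarrow> nat \<Rightarrow> real mat" where
  "two_grid_B A M P l = two_level_op (A l) (M l) (P l) (mat_inv (A (Suc l)))"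

text \<open>Level \<open>J\<close> is the coarsest level. Values at levels outside \<open>1, \<dots>, J\<close> are irrelevant.\<close>

function amli_B amli_B_hat ::
  "nat \<Rightarrow> (nat \<Rightarrow> real mat) \<Rightarrow> (nat \<Rightarrow> real mat) \<Rightarrow> (nat \<Rightarrow> real mat) \<Rightarrow> real poly
     \<Rightarrow> nat \<Rightarrow> real mat" where
  "amli_B J A M P p l =
     (if l < J then two_level_op (A l) (M l) (P l) (amli_B_hat J A M P p (Suc l))
      else mat_inv (A l))"
| "amli_B_hat J A M P p l =
     (if l < J then
        (1\<^sub>m (dim_row (A l)) - poly_of_mat p (amli_B J A M P p l * A l)) * mat_inv (A l)
      else mat_inv (A l))"
  by pat_completeness auto
termination
  by (relation "measure (case_sum (\<lambda>(J, _, _, _, _, l). 2 * (J - l))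
                                  (\<lambda>(J, _, _, _, _, l). 2 * (J - l) + 1))") auto

declare amli_B.simps [simp del] amli_B_hat.simps [simp del]

fun ma_poly :: "real \<Rightarrow> nat \<Rightarrow> real poly" where
  "ma_poly a 0 = 1"
| "ma_poly a (Suc 0) = [:1, -1:]"
| "ma_poly a (Suc (Suc j)) =
     2 * [:1, -a:] * ma_poly a (Suc j) - [:1, -a:] * ma_poly a j"

definition two_grid_converges ::
  "nat \<Rightarrow> (nat \<Rightarrow> real mat) \<Rightarrow> (nat \<Rightarrow> real mat) \<Rightarrow> (nat \<Rightarrow> real mat) \<Rightarrow> real \<Rightarrow> bool" where
  "two_grid_converges J A M P \<delta> \<longleftrightarrow> 0 \<le> \<delta> \<and> \<delta> < 1 \<and>
     (\<forall>l \<in> {1..J - 1}. lambda_min (two_grid_B A M P l * A l) \<ge> 1 - \<delta> \<and>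
                       lambda_max (two_grid_B A M P l * A l) \<le> 1)"

definition amli_setting ::
  "nat \<Rightarrow> (nat \<Rightarrow> nat) \<Rightarrow> (nat \<Rightarrow> real mat) \<Rightarrow> (nat \<Rightarrow> real mat) \<Rightarrow> (nat \<Rightarrow> real mat)
     \<Rightarrow> bool" where
  "amli_setting J n A M P \<longleftrightarrow> J \<ge> 2 \<and>
     (\<forall>l \<in> {1..J}. n l > 0 \<and> spd (n l) (A l)) \<and>
     (\<forall>l \<in> {1..J - 1}.
        P l \<in> carrier_mat (n l) (n (Suc l)) \<and>
        A (Suc l) = transpose_mat (P l) * A l * P l \<and>
        M l \<in> carrier_mat (n l) (n l) \<and> invertible_mat (M l) \<and>
        energy_opnorm (A l) (1\<^sub>m (n l) - M l * A l) \<le> 1)"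

end

theory Submission
  imports Defs
begin

text \<open>The whole argument compares quadratic forms. For SPD \<open>A\<close> and symmetric \<open>B\<close> the operator
  \<open>B A\<close> is self-adjoint in the \<open>A\<close>-inner product, so its spectrum lies in \<open>[c, d]\<close> iff
  \<open>c A\<^sup>-\<^sup>1 \<le> B \<le> d A\<^sup>-\<^sup>1\<close> in the sense of quadratic forms; this is
  \<open>preconditioner_bounds\<close>. By induction from the coarsest level, \<open>\<mu> A\<^sup>-\<^sup>1 \<le> B \<le> 2 A\<^sup>-\<^sup>1\<close> holds on
  every level, and the bound on the condition number is read off from the spectrum.

  Suppose that it holds on level \<open>l + 1\<close>. On \<open>[\<mu>, 2]\<close> the polynomial satisfies
  \<open>- 1 \<le> p \<le> p(\<mu>)\<close>: the upper estimate is what the hypotheses on \<open>\<nu>\<close> say, and the lower one holds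
  because MA polynomials are bounded by \<open>1\<close> in modulus on \<open>[0, 1]\<close> (\<open>ma_poly_abs_le_1\<close>). By
  spectral mapping the accelerated coarse operator \<open>C\<close> lies between \<open>c\<close> and \<open>2\<close> times the exact
  coarse inverse, where \<open>c = 1 - p(\<mu>) \<le> 1\<close> (\<open>preconditioner_bounds_poly_acceleration\<close>).

  The two-level operator is a form \<open>M_bar\<close>, nonnegative since the smoother is nonexpansive, plus a
  congruence transform of the coarse operator. As \<open>c \<le> 1 \<le> 2\<close>, replacing the exact coarse
  inverse by \<open>C\<close> changes the two-grid operator \<open>B_TG\<close> by factors between \<open>c\<close> and \<open>2\<close> only:
  \<open>c B_TG \<le> B \<le> 2 B_TG\<close> (\<open>two_level_op_compare\<close>). With
  \<open>(1 - \<delta>) A\<^sup>-\<^sup>1 \<le> B_TG \<le> A\<^sup>-\<^sup>1\<close> and \<open>\<mu> \<le> (1 - \<delta>) c\<close> the induction closes.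

  Two facts from spectral theory carry this. The smallest Rayleigh quotient of a symmetric form
  with respect to an SPD form is an eigenvalue (\<open>pencil_smallest_eigenvalue\<close>), and every
  eigenvalue of a polynomial in a self-adjoint operator is the value of the polynomial at a real
  eigenvalue (\<open>eigenvalue_poly_of_mat\<close>). Together they give form bounds from eigenvalue bounds
  without diagonalising anything.\<close>

section \<open>MA polynomials on the unit interval\<close>

lemma poly_ma_poly_Suc_Suc:
  "poly (ma_poly a (Suc (Suc j))) x =
     2 * (1 - a * x) * poly (ma_poly a (Suc j)) x - (1 - a * x) * poly (ma_poly a j) x"
  by (simp add: algebra_simps)

lemma cos_add_2:
  fixes \<theta> :: real
  shows "cos (real (Suc (Suc i)) * \<theta>) = 2 * cos \<theta> * cos (real (Suc i) * \<theta>) - cos (real i * \<theta>)"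
proof -
  have 1: "real (Suc (Suc i)) * \<theta> = real (Suc i) * \<theta> + \<theta>"
    and 2: "real i * \<theta> = real (Suc i) * \<theta> - \<theta>"
    by (simp_all add: distrib_right)
  show ?thesis unfolding 1 2 by (simp add: cos_add cos_diff)
qed

lemma cos_power_recurrence:
  fixes \<theta> :: real
  shows "cos \<theta> ^ Suc (Suc j) * cos (real (Suc (Suc i)) * \<theta>) =
    2 * (cos \<theta>)\<^sup>2 * (cos \<theta> ^ Suc j * cos (real (Suc i) * \<theta>)) -
    (cos \<theta>)\<^sup>2 * (cos \<theta> ^ j * cos (real i * \<theta>))"
  unfolding cos_add_2[of i] by (simp add: algebra_simps power2_eq_square del: of_nat_Suc)

text \<open>With \<open>y = 1 - a x = cos\<^sup>2 \<theta>\<close> the characteristic roots of the recurrence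
  \<open>r\<^sup>2 = 2 y r - y\<close> are \<open>cos \<theta> e\<^bsup>\<plusminus>i\<theta>\<^esup>\<close>, so the solutions are combinations of shifted
  sequences \<open>cos\<^sup>j \<theta> cos (j \<theta>)\<close>. The factor \<open>a\<close> on the left avoids the division in
  \<open>p\<^sub>1 = 1 - (1 - cos\<^sup>2 \<theta>) / a\<close>.\<close>

lemma ma_poly_cos_form:
  fixes a x \<theta> :: real
  assumes y: "1 - a * x = (cos \<theta>)\<^sup>2"
  shows "a * poly (ma_poly a (Suc j)) x =
           cos \<theta> ^ Suc j * cos (real (Suc j) * \<theta>) + (a - 1) * (cos \<theta> ^ j * cos (real j * \<theta>))"
proof (induction j rule: induct_nat_012)
  case 0
  then show ?case using y by (simp add: algebra_simps power2_eq_square)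
next
  case 1
  have c2: "cos (real (Suc (Suc 0)) * \<theta>) = 2 * (cos \<theta>)\<^sup>2 - 1"
    by (simp add: cos_double_cos)
  have "a * poly (ma_poly a (Suc (Suc 0))) x = 2 * (1 - a*x) * (a - a * x) - (1 - a * x) * a"
    by (simp add: poly_ma_poly_Suc_Suc algebra_simps del: ma_poly.simps(3))
  moreover have "a * x = 1 - (cos \<theta>)\<^sup>2" using y by simp
  ultimately have "a * poly (ma_poly a (Suc (Suc 0))) x =
      2 * (cos \<theta>)\<^sup>2 * (a - 1 + (cos \<theta>)\<^sup>2) - (cos \<theta>)\<^sup>2 * a" by simp
  then show ?case
    unfolding c2 by (simp add: algebra_simps power2_eq_square del: ma_poly.simps(3))
next
  case (ge2 j)
  have "a * poly (ma_poly a (Suc (Suc (Suc j)))) x =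
      2 * (cos \<theta>)\<^sup>2 * (a * poly (ma_poly a (Suc (Suc j))) x) - (cos \<theta>)\<^sup>2 * (a * poly (ma_poly a (Suc j)) x)"
    unfolding poly_ma_poly_Suc_Suc y by (simp add: algebra_simps)
  also note ge2(1)
  also note ge2(2)
  finally show ?case
    unfolding cos_power_recurrence[of _ "Suc j"] cos_power_recurrence[of _ j] 
    by (simp add: algebra_simps del: power_Suc of_nat_Suc)
qed

lemma abs_cos_power_mult_cos_le_1: "\<bar>cos \<theta> ^ j * cos \<phi>\<bar> \<le> (1::real)"
proof -
  have "\<bar>cos \<theta>\<bar> ^ j * \<bar>cos \<phi>\<bar> \<le> 1 * 1"
    by (intro mult_mono power_le_one) auto
  then show ?thesis by (simp add: abs_mult power_abs)
qed

text \<open>For \<open>a x \<le> 1\<close> the closed form makes \<open>p\<close> a convex combination of numbers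
  \<open>cos\<^sup>i \<theta> cos \<phi>\<close>. If \<open>a \<ge> 1\<close> it is one already; if \<open>a < 1\<close> the negative weight \<open>a - 1\<close> is removed
  by trading the term of index \<open>j\<close> for \<open>cos\<^sup>j \<theta> cos ((j + 2) \<theta>)\<close>, which leaves the weight
  \<open>2 a - 1\<close>, nonnegative exactly when \<open>a \<ge> 1/2\<close>. For \<open>a x > 1\<close> the bound \<open>a \<le> 4/3\<close> gives
  \<open>\<bar>1 - a x\<bar> \<le> 1/3\<close>, and the recurrence multiplies the maximum of two consecutive values by at
  most \<open>3 \<bar>1 - a x\<bar>\<close>.\<close>

lemma ma_poly_abs_le_1:
  fixes a x :: real
  assumes a: "1/2 \<le> a" "a \<le> 4/3" and x: "0 \<le> x" "x \<le> 1"
  shows "\<bar>poly (ma_poly a k) x\<bar> \<le> 1"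
proof (cases "a * x \<le> 1")
  case True
  define \<theta> where "\<theta> = arccos (sqrt (1 - a * x))"
  have "0 \<le> a * x" using a x by simp
  with True have y: "1 - a * x = (cos \<theta>)\<^sup>2"
    unfolding \<theta>_def by (subst cos_arccos) (auto intro: order_trans[of _ 0])
  show ?thesis
  proof (cases k)
    case (Suc j)
    define Q where "Q i = cos \<theta> ^ i * cos (real i * \<theta>)" for i
    define R where "R = cos \<theta> ^ j * cos (real (Suc (Suc j)) * \<theta>)"
    have Q: "\<bar>Q i\<bar> \<le> 1" for i unfolding Q_def by (rule abs_cos_power_mult_cos_le_1)
    have R: "\<bar>R\<bar> \<le> 1" unfolding R_def by (rule abs_cos_power_mult_cos_le_1)
    have p: "a * poly (ma_poly a k) x = Q (Suc j) + (a - 1) * Q j"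
      unfolding Suc Q_def by (rule ma_poly_cos_form[OF y])
    have "\<bar>a * poly (ma_poly a k) x\<bar> \<le> a"
    proof (cases "a \<le> 1")
      case True
      have "R = 2 * Q (Suc j) - Q j"
        unfolding Q_def R_def cos_add_2[of j] by (simp add: algebra_simps del: of_nat_Suc)
      then have Qj: "Q j = 2 * Q (Suc j) - R" by simp
      have "a * poly (ma_poly a k) x = (2 * a - 1) * Q (Suc j) + (1 - a) * R"
        unfolding p Qj by (simp add: algebra_simps)
      also have "\<bar>\<dots>\<bar> \<le> \<bar>(2 * a - 1) * Q (Suc j)\<bar> + \<bar>(1 - a) * R\<bar>" by (rule abs_triangle_ineq)
      also have "\<dots> \<le> (2 * a - 1) * 1 + (1 - a) * 1"
        unfolding abs_mult by (intro add_mono mult_mono) (use a True Q[of "Suc j"] R in auto)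
      finally show ?thesis by simp
    next
      case False
      have "\<bar>a * poly (ma_poly a k) x\<bar> \<le> \<bar>Q (Suc j)\<bar> + \<bar>(a - 1) * Q j\<bar>"
        unfolding p by (rule abs_triangle_ineq)
      also have "\<dots> \<le> 1 + (a - 1) * 1"
        unfolding abs_mult by (intro add_mono mult_mono) (use False Q[of "Suc j"] Q[of j] in auto)
      finally show ?thesis by simp
    qed
    then have "a * \<bar>poly (ma_poly a k) x\<bar> \<le> a * 1" using a by (simp add: abs_mult)
    then show ?thesis using a by (simp only: mult_le_cancel_left_pos)
  qed simp
next
  case False
  have "a * x \<le> 4/3 * 1" using a x by (intro mult_mono) auto
  with False have y: "\<bar>1 - a * x\<bar> \<le> 1/3" by simp
  show ?thesis
  proof (induction k rule: induct_nat_012)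
    case (ge2 j)
    have "\<bar>poly (ma_poly a (Suc (Suc j))) x\<bar> =
        \<bar>1 - a * x\<bar> * \<bar>2 * poly (ma_poly a (Suc j)) x - poly (ma_poly a j) x\<bar>"
      unfolding poly_ma_poly_Suc_Suc by (simp add: algebra_simps flip: abs_mult)
    also have "\<dots> \<le> 1/3 * 3"
      using y ge2 by (intro mult_mono) auto
    finally show ?case by simp
  qed (use x in auto)
qed

section \<open>Quadratic forms\<close>

definition quad_form :: "real mat \<Rightarrow> real vec \<Rightarrow> real" where
  "quad_form X v = (X *\<^sub>v v) \<bullet> v"

definition sym_mat :: "nat \<Rightarrow> real mat \<Rightarrow> bool" where
  "sym_mat n X \<longleftrightarrow> X \<in> carrier_mat n n \<and> X\<^sup>T = X"

lemma sym_mat_carrier: "sym_mat n X \<Longrightarrow> X \<in> carrier_mat n n"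
  by (simp add: sym_mat_def)

lemma sym_mat_minus: "sym_mat n X \<Longrightarrow> sym_mat n Y \<Longrightarrow> sym_mat n (X - Y)"
  unfolding sym_mat_def by (metis minus_carrier_mat transpose_minus)

lemma sym_mat_smult:
  assumes "sym_mat n X"
  shows "sym_mat n (c \<cdot>\<^sub>m X)"
proof -
  have "(c \<cdot>\<^sub>m X)\<^sup>T = c \<cdot>\<^sub>m X\<^sup>T" by (intro eq_matI) auto
  with assms show ?thesis by (simp add: sym_mat_def)
qed

lemma sym_mat_scalar_prod:
  assumes "sym_mat n X" "v \<in> carrier_vec n" "w \<in> carrier_vec n"
  shows "(X *\<^sub>v v) \<bullet> w = (X *\<^sub>v w) \<bullet> v"
proof -
  have X: "X \<in> carrier_mat n n" and T: "X\<^sup>T = X" using assms by (auto simp: sym_mat_def)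
  have "(X *\<^sub>v v) \<bullet> w = v \<bullet> (X *\<^sub>v w)"
    using transpose_vec_mult_scalar[OF X assms(3) assms(2)] T by simp
  also have "\<dots> = (X *\<^sub>v w) \<bullet> v" using X assms by (intro comm_scalar_prod[of _ n]) auto
  finally show ?thesis .
qed

lemma smult_mat_mult_vec:
  fixes X :: "'a::comm_semiring_0 mat"
  assumes "X \<in> carrier_mat m n" "v \<in> carrier_vec n"
  shows "(c \<cdot>\<^sub>m X) *\<^sub>v v = c \<cdot>\<^sub>v (X *\<^sub>v v)"
  using assms by (intro eq_vecI) auto

lemma scalar_prod_self_nonneg: "(v :: real vec) \<bullet> v \<ge> 0"
  by (simp add: scalar_prod_def sum_nonneg)

lemma quad_form_bounded:
  assumes X: "X \<in> carrier_mat n n"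
  obtains C where "C > 0" "\<And>v. v \<in> carrier_vec n \<Longrightarrow> \<bar>quad_form X v\<bar> \<le> C * (v \<bullet> v)"
proof -
  define C where "C = (\<Sum>i<n. \<Sum>j<n. \<bar>X $$ (i, j)\<bar>) + 1"
  have C: "C > 0"
    unfolding C_def by (intro add_nonneg_pos sum_nonneg) simp_all
  have "\<bar>quad_form X v\<bar> \<le> C * (v \<bullet> v)" if v: "v \<in> carrier_vec n" for v
  proof -
    have vv: "v \<bullet> v = (\<Sum>i<n. (v $ i)\<^sup>2)"
      using v by (simp add: scalar_prod_def power2_eq_square atLeast0LessThan)
    have le: "\<bar>v $ j\<bar> * \<bar>v $ i\<bar> \<le> v \<bullet> v" if "i < n" "j < n" for i j
    proof -
      have "(v $ k)\<^sup>2 \<le> v \<bullet> v" if "k < n" for k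
        unfolding vv by (rule member_le_sum) (use that in auto)
      with that have "\<bar>v $ j\<bar>\<^sup>2 \<le> v \<bullet> v" "\<bar>v $ i\<bar>\<^sup>2 \<le> v \<bullet> v" by auto
      moreover have "2 * (\<bar>v $ j\<bar> * \<bar>v $ i\<bar>) \<le> \<bar>v $ j\<bar>\<^sup>2 + \<bar>v $ i\<bar>\<^sup>2"
        using sum_squares_bound[of "\<bar>v $ j\<bar>" "\<bar>v $ i\<bar>"] by simp
      ultimately show ?thesis by simp
    qed
    have "quad_form X v = (\<Sum>i<n. \<Sum>j<n. X $$ (i, j) * (v $ j * v $ i))"
      using X v by (simp add: quad_form_def scalar_prod_def atLeast0LessThan sum_distrib_right mult.assoc)
    also have "\<bar>\<dots>\<bar> \<le> (\<Sum>i<n. \<Sum>j<n. \<bar>X $$ (i, j) * (v $ j * v $ i)\<bar>)"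
      by (rule order_trans[OF sum_abs sum_mono[OF sum_abs]])
    also have "\<dots> \<le> (\<Sum>i<n. \<Sum>j<n. \<bar>X $$ (i, j)\<bar> * (v \<bullet> v))"
      unfolding abs_mult by (intro sum_mono mult_left_mono le) auto
    also have "\<dots> \<le> C * (v \<bullet> v)"
      unfolding C_def by (simp add: sum_distrib_right distrib_right scalar_prod_self_nonneg)
    finally show ?thesis .
  qed
  with C that show thesis by blast
qed

lemma mult_mat_vec_bounded:
  fixes X :: "real mat"
  assumes X: "X \<in> carrier_mat n n"
  obtains C where "C > 0" "\<And>v. v \<in> carrier_vec n \<Longrightarrow> (X *\<^sub>v v) \<bullet> (X *\<^sub>v v) \<le> C * (v \<bullet> v)"
proof -
  have "X\<^sup>T * X \<in> carrier_mat n n" using X by simp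
  from quad_form_bounded[OF this] obtain C where C: "C > 0"
    "\<And>v. v \<in> carrier_vec n \<Longrightarrow> \<bar>quad_form (X\<^sup>T * X) v\<bar> \<le> C * (v \<bullet> v)" by blast
  have "quad_form (X\<^sup>T * X) v = (X *\<^sub>v v) \<bullet> (X *\<^sub>v v)" if v: "v \<in> carrier_vec n" for v
    using X v transpose_vec_mult_scalar[OF X v, of "X *\<^sub>v v"]
    by (simp add: quad_form_def assoc_mult_mat_vec[of _ n n _ n])
  with C that show thesis by fastforce
qed

lemma quad_form_add:
  assumes "X \<in> carrier_mat n n" "Y \<in> carrier_mat n n" "v \<in> carrier_vec n"
  shows "quad_form (X + Y) v = quad_form X v + quad_form Y v"
  using assms by (simp add: quad_form_def add_mult_distrib_mat_vec[of _ n n] add_scalar_prod_distrib[of _ n])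

lemma quad_form_minus:
  assumes "X \<in> carrier_mat n n" "Y \<in> carrier_mat n n" "v \<in> carrier_vec n"
  shows "quad_form (X - Y) v = quad_form X v - quad_form Y v"
  using assms
  by (simp add: quad_form_def minus_mult_distrib_mat_vec[of _ n n] minus_scalar_prod_distrib[of _ n])

lemma quad_form_smult:
  assumes "X \<in> carrier_mat n n" "v \<in> carrier_vec n"
  shows "quad_form (c \<cdot>\<^sub>m X) v = c * quad_form X v"
  using assms by (simp add: quad_form_def smult_mat_mult_vec)

lemma mat_inv_of_trivial_kernel:
  fixes X :: "real mat"
  assumes X: "X \<in> carrier_mat n n" and ker: "\<And>v. v \<in> carrier_vec n \<Longrightarrow> X *\<^sub>v v = 0\<^sub>v n \<Longrightarrow> v = 0\<^sub>v n"
  shows "mat_inv X \<in> carrier_mat n n" "X * mat_inv X = 1\<^sub>m n" "mat_inv X * X = 1\<^sub>m n"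
proof -
  have "det X \<noteq> 0" using det_0_iff_vec_prod_zero_field[OF X] ker by blast
  then have "X \<in> Units (ring_mat TYPE(real) n ())" by (rule det_non_zero_imp_unit[OF X])
  then obtain Y where "mat_inverse X = Some Y" using mat_inverse(1)[OF X, of "()"] by (cases "mat_inverse X") auto
  with mat_inverse(2)[OF X this]
  show "mat_inv X \<in> carrier_mat n n" "X * mat_inv X = 1\<^sub>m n" "mat_inv X * X = 1\<^sub>m n" by auto
qed

section \<open>The smallest eigenvalue of a definite pencil\<close>

text \<open>Evaluating the form at \<open>v - t K v\<close> with \<open>t = 1 / C\<close>, where \<open>C\<close> bounds \<open>K\<close>, yields
  \<open>\<bar>K v\<bar>\<^sup>2 \<le> C (K v, v)\<close>; boundedness of the inverse turns \<open>\<bar>K v\<bar>\<close> into \<open>\<bar>v\<bar>\<close>. This replaces a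
  compactness argument on the unit sphere.\<close>

lemma psd_invertible_imp_coercive:
  assumes K: "sym_mat n K"
    and psd: "\<And>v. v \<in> carrier_vec n \<Longrightarrow> quad_form K v \<ge> 0"
    and ker: "\<And>v. v \<in> carrier_vec n \<Longrightarrow> K *\<^sub>v v = 0\<^sub>v n \<Longrightarrow> v = 0\<^sub>v n"
  obtains c where "c > 0" "\<And>v. v \<in> carrier_vec n \<Longrightarrow> c * (v \<bullet> v) \<le> quad_form K v"
proof -
  have Kc: "K \<in> carrier_mat n n" using K by (rule sym_mat_carrier)
  note inv = mat_inv_of_trivial_kernel[OF Kc ker]
  obtain C where C: "C > 0" "\<And>v. v \<in> carrier_vec n \<Longrightarrow> \<bar>quad_form K v\<bar> \<le> C * (v \<bullet> v)"
    using quad_form_bounded[OF Kc] by blast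
  obtain D where D: "D > 0"
    "\<And>v. v \<in> carrier_vec n \<Longrightarrow> (mat_inv K *\<^sub>v v) \<bullet> (mat_inv K *\<^sub>v v) \<le> D * (v \<bullet> v)"
    using mult_mat_vec_bounded[OF inv(1)] by blast
  have "1 / (C * D) * (v \<bullet> v) \<le> quad_form K v" if v: "v \<in> carrier_vec n" for v
  proof -
    define w where "w = K *\<^sub>v v"
    have w: "w \<in> carrier_vec n" using Kc v by (simp add: w_def)
    define t where "t = 1 / C"
    have u: "v - t \<cdot>\<^sub>v w \<in> carrier_vec n" using v w by simp
    have Ku: "K *\<^sub>v (v - t \<cdot>\<^sub>v w) = w - t \<cdot>\<^sub>v (K *\<^sub>v w)"
      using Kc v w by (simp add: mult_minus_distrib_mat_vec[of _ n n] mult_mat_vec[of _ n n] w_def)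
    have sym: "(K *\<^sub>v w) \<bullet> v = w \<bullet> w"
      using sym_mat_scalar_prod[OF K w v] by (simp add: w_def)
    have Kw: "K *\<^sub>v w \<in> carrier_vec n" using Kc w by simp
    have "0 \<le> quad_form K (v - t \<cdot>\<^sub>v w)" by (rule psd[OF u])
    also have "\<dots> = quad_form K v - 2 * t * (w \<bullet> w) + t\<^sup>2 * quad_form K w"
      unfolding quad_form_def Ku using v w Kw
      by (simp add: minus_scalar_prod_distrib[of _ n] scalar_prod_minus_distrib[of _ n] sym
          power2_eq_square algebra_simps flip: w_def)
    also have "quad_form K w \<le> C * (w \<bullet> w)" using C(2)[OF w] by simp
    finally have "0 \<le> quad_form K v - 2 * t * (w \<bullet> w) + t\<^sup>2 * (C * (w \<bullet> w))"
      by (simp add: mult_left_mono)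
    then have 1: "w \<bullet> w / C \<le> quad_form K v"
      using C(1) by (simp add: t_def power2_eq_square field_simps)
    have "mat_inv K *\<^sub>v w = (mat_inv K * K) *\<^sub>v v" using inv(1) Kc v by (simp add: w_def)
    then have "mat_inv K *\<^sub>v w = v" using inv(3) v by simp
    then have "v \<bullet> v \<le> D * (w \<bullet> w)" using D(2)[OF w] by simp
    then have "1 / (C * D) * (v \<bullet> v) \<le> w \<bullet> w / C" using C(1) D(1) by (simp add: field_simps)
    with 1 show ?thesis by simp
  qed
  with C(1) D(1) that[of "1 / (C * D)"] show thesis by simp
qed

lemma spd_sym_mat: "spd n A \<Longrightarrow> sym_mat n A"
  by (simp add: spd_def sym_mat_def)

lemma quad_form_0: "X \<in> carrier_mat n n \<Longrightarrow> quad_form X (0\<^sub>v n) = 0"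
  by (simp add: quad_form_def scalar_prod_def)

lemma spd_quad_form_pos: "spd n A \<Longrightarrow> v \<in> carrier_vec n \<Longrightarrow> v \<noteq> 0\<^sub>v n \<Longrightarrow> quad_form A v > 0"
  by (simp add: spd_def quad_form_def)

lemma spd_quad_form_nonneg: "spd n A \<Longrightarrow> v \<in> carrier_vec n \<Longrightarrow> quad_form A v \<ge> 0"
  using spd_quad_form_pos[of n A v] quad_form_0[of A n] by (cases "v = 0\<^sub>v n") (auto simp: spd_def)

lemma spd_kernel:
  assumes A: "spd n A" and v: "v \<in> carrier_vec n" and "A *\<^sub>v v = 0\<^sub>v n"
  shows "v = 0\<^sub>v n"
  using spd_quad_form_pos[OF A v] assms by (auto simp: quad_form_def)

text \<open>Let \<open>s\<close> be the largest number with \<open>K - s A \<ge> 0\<close>. If \<open>K - s A\<close> were invertible it would be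
  coercive, hence dominate a positive multiple of \<open>A\<close>, and \<open>s\<close> could be increased. So it has a
  kernel vector, which is an eigenvector of the pencil for its smallest eigenvalue.\<close>

lemma pencil_smallest_eigenvalue:
  assumes n: "n > 0" and A: "spd n A" and K: "sym_mat n K"
  obtains s v where "v \<in> carrier_vec n" "v \<noteq> 0\<^sub>v n" "K *\<^sub>v v = s \<cdot>\<^sub>v (A *\<^sub>v v)"
    "\<And>w. w \<in> carrier_vec n \<Longrightarrow> s * quad_form A w \<le> quad_form K w"
proof -
  have Ac: "A \<in> carrier_mat n n" and Kc: "K \<in> carrier_mat n n"
    using A K by (auto simp: spd_def sym_mat_def)
  define S where "S = {s. \<forall>w\<in>carrier_vec n. s * quad_form A w \<le> quad_form K w}"
  obtain c where c: "c > 0" "\<And>v. v \<in> carrier_vec n \<Longrightarrow> c * (v \<bullet> v) \<le> quad_form A v"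
    using psd_invertible_imp_coercive[OF spd_sym_mat[OF A] spd_quad_form_nonneg[OF A] spd_kernel[OF A]]
    by blast
  obtain D where D: "D > 0" "\<And>v. v \<in> carrier_vec n \<Longrightarrow> \<bar>quad_form K v\<bar> \<le> D * (v \<bullet> v)"
    using quad_form_bounded[OF Kc] by blast
  obtain C where C: "C > 0" "\<And>v. v \<in> carrier_vec n \<Longrightarrow> \<bar>quad_form A v\<bar> \<le> C * (v \<bullet> v)"
    using quad_form_bounded[OF Ac] by blast
  \<comment> \<open>\<open>K \<ge> - D I\<close> and \<open>A \<ge> c I\<close>\<close>
  have "- (D / c) \<in> S"
    unfolding S_def
  proof (clarify)
    fix w :: "real vec" assume w: "w \<in> carrier_vec n"
    have "D * (w \<bullet> w) \<le> D / c * quad_form A w"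
      using mult_left_mono[OF c(2)[OF w], of "D / c"] c(1) D(1) by simp
    with D(2)[OF w] show "- (D / c) * quad_form A w \<le> quad_form K w" by simp
  qed
  then have ne: "S \<noteq> {}" by blast
  define e :: "real vec" where "e = unit_vec n 0"
  have e: "e \<in> carrier_vec n" "e \<noteq> 0\<^sub>v n"
    using n by (auto simp: e_def dest: arg_cong[where f = "\<lambda>v. v $ 0"])
  have Ae: "quad_form A e > 0" by (rule spd_quad_form_pos[OF A e])
  have bdd: "bdd_above S"
    by (rule bdd_aboveI[of _ "quad_form K e / quad_form A e"])
       (use e Ae in \<open>auto simp: S_def field_simps\<close>)
  define s where "s = Sup S"
  have s: "s * quad_form A w \<le> quad_form K w" if w: "w \<in> carrier_vec n" for w
  proof (cases "w = 0\<^sub>v n")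
    case True
    then show ?thesis using quad_form_0[OF Ac] quad_form_0[OF Kc] by simp
  next
    case False
    then have pos: "quad_form A w > 0" by (rule spd_quad_form_pos[OF A w])
    have "s \<le> quad_form K w / quad_form A w"
      unfolding s_def by (rule cSup_least[OF ne]) (use w pos in \<open>auto simp: S_def field_simps\<close>)
    then show ?thesis using pos by (simp add: field_simps)
  qed
  define L where "L = K - s \<cdot>\<^sub>m A"
  have L: "sym_mat n L"
    unfolding L_def by (intro sym_mat_minus sym_mat_smult K spd_sym_mat[OF A])
  have qL: "quad_form L w = quad_form K w - s * quad_form A w" if "w \<in> carrier_vec n" for w
    unfolding L_def using Ac Kc that by (simp add: quad_form_minus[of _ n] quad_form_smult[of _ n])
  have "\<exists>v. v \<in> carrier_vec n \<and> v \<noteq> 0\<^sub>v n \<and> L *\<^sub>v v = 0\<^sub>v n"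
  proof (rule ccontr)
    assume "\<not> ?thesis"
    then have ker: "\<And>v. v \<in> carrier_vec n \<Longrightarrow> L *\<^sub>v v = 0\<^sub>v n \<Longrightarrow> v = 0\<^sub>v n" by blast
    have psd: "quad_form L w \<ge> 0" if "w \<in> carrier_vec n" for w using qL[OF that] s[OF that] by simp
    obtain d where d: "d > 0" "\<And>v. v \<in> carrier_vec n \<Longrightarrow> d * (v \<bullet> v) \<le> quad_form L v"
      using psd_invertible_imp_coercive[OF L psd ker] by blast
    \<comment> \<open>\<open>L \<ge> d I\<close> and \<open>A \<le> C I\<close>, so \<open>L\<close> dominates \<open>(d / C) A\<close>\<close>
    have "s + d / C \<in> S" unfolding S_def
    proof clarify
      fix w :: "real vec" assume w: "w \<in> carrier_vec n"
      have "d / C * quad_form A w \<le> d / C * (C * (w \<bullet> w))"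
        using C(2)[OF w] C(1) d(1) by (intro mult_left_mono) auto
      also have "\<dots> = d * (w \<bullet> w)" using C(1) by simp
      also have "\<dots> \<le> quad_form L w" by (rule d(2)[OF w])
      finally show "(s + d / C) * quad_form A w \<le> quad_form K w"
        using qL[OF w] by (simp add: distrib_right)
    qed
    then have "s + d / C \<le> s" unfolding s_def by (rule cSup_upper[OF _ bdd])
    moreover have "d / C > 0" using d(1) C(1) by simp
    ultimately show False by simp
  qed
  then obtain v where v: "v \<in> carrier_vec n" "v \<noteq> 0\<^sub>v n" "L *\<^sub>v v = 0\<^sub>v n" by blast
  have 0: "K *\<^sub>v v - s \<cdot>\<^sub>v (A *\<^sub>v v) = 0\<^sub>v n"
    using v Ac Kc by (simp add: L_def minus_mult_distrib_mat_vec[of _ n n] smult_mat_mult_vec[of _ n n])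
  have "(K *\<^sub>v v) $ i = (s \<cdot>\<^sub>v (A *\<^sub>v v)) $ i" if "i < n" for i
    using arg_cong[OF 0, of "\<lambda>w. w $ i"] that Ac Kc v(1) by simp
  then have "K *\<^sub>v v = s \<cdot>\<^sub>v (A *\<^sub>v v)"
    using Ac Kc v(1) by (intro eq_vecI) auto
  with v s that show thesis by blast
qed

section \<open>Spectral mapping for self-adjoint operators\<close>

text \<open>Split an eigenvector into real and imaginary parts \<open>x + i y\<close>. Symmetry of \<open>A T\<close> on the pair
  \<open>x, y\<close> gives \<open>Im z ((A x, x) + (A y, y)) = 0\<close>, so \<open>z\<close> is real; then both \<open>x\<close> and \<open>y\<close> are
  eigenvectors unless zero.\<close>

lemma complex_eigenvalue_pencil_real:
  assumes A: "spd n A" and T: "T \<in> carrier_mat n n" and K: "sym_mat n (A * T)"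
    and z: "eigenvalue (map_mat complex_of_real T) z"
  shows "z \<in> \<real>" "eigenvalue T (Re z)"
proof -
  have Ac: "A \<in> carrier_mat n n" using A by (simp add: spd_def)
  obtain u where u: "u \<in> carrier_vec n" "u \<noteq> 0\<^sub>v n" "map_mat complex_of_real T *\<^sub>v u = z \<cdot>\<^sub>v u"
    using z T by (auto simp: eigenvalue_def eigenvector_def)
  define x where "x = map_vec Re u"
  define y where "y = map_vec Im u"
  define \<alpha> where "\<alpha> = Re z"
  define \<beta> where "\<beta> = Im z"
  have xy: "x \<in> carrier_vec n" "y \<in> carrier_vec n" using u by (auto simp: x_def y_def)
  have "(T *\<^sub>v x) $ i = Re ((map_mat complex_of_real T *\<^sub>v u) $ i)"
       "(T *\<^sub>v y) $ i = Im ((map_mat complex_of_real T *\<^sub>v u) $ i)" if "i < n" for i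
    using T u(1) that by (simp_all add: scalar_prod_def x_def y_def)
  note row = this[unfolded u(3)]
  have Tx: "T *\<^sub>v x = \<alpha> \<cdot>\<^sub>v x - \<beta> \<cdot>\<^sub>v y"
  proof (rule eq_vecI)
    fix i assume "i < dim_vec (\<alpha> \<cdot>\<^sub>v x - \<beta> \<cdot>\<^sub>v y)"
    then have "i < n" using xy by simp
    with row(1)[OF this] show "(T *\<^sub>v x) $ i = (\<alpha> \<cdot>\<^sub>v x - \<beta> \<cdot>\<^sub>v y) $ i"
      using u(1) T xy by (simp add: \<alpha>_def \<beta>_def x_def y_def)
  qed (use T xy in auto)
  have Ty: "T *\<^sub>v y = \<alpha> \<cdot>\<^sub>v y + \<beta> \<cdot>\<^sub>v x"
  proof (rule eq_vecI)
    fix i assume "i < dim_vec (\<alpha> \<cdot>\<^sub>v y + \<beta> \<cdot>\<^sub>v x)"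
    then have "i < n" using xy by simp
    with row(2)[OF this] show "(T *\<^sub>v y) $ i = (\<alpha> \<cdot>\<^sub>v y + \<beta> \<cdot>\<^sub>v x) $ i"
      using u(1) T xy by (simp add: \<alpha>_def \<beta>_def x_def y_def)
  qed (use T xy in auto)
  have ne: "x \<noteq> 0\<^sub>v n \<or> y \<noteq> 0\<^sub>v n"
  proof (rule ccontr)
    assume "\<not> ?thesis"
    then have *: "x $ i = 0\<^sub>v n $ i" "y $ i = 0\<^sub>v n $ i" for i by auto
    have "u $ i = 0" if "i < n" for i
      using *[of i] that u(1) by (simp add: x_def y_def complex_eq_iff)
    then have "u = 0\<^sub>v n" using u(1) by (intro eq_vecI) auto
    with u(2) show False by simp
  qed
  have KTx: "(A * T) *\<^sub>v x = \<alpha> \<cdot>\<^sub>v (A *\<^sub>v x) - \<beta> \<cdot>\<^sub>v (A *\<^sub>v y)"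
    using Ac T xy
    by (simp add: assoc_mult_mat_vec[of _ n n _ n] Tx mult_minus_distrib_mat_vec[of _ n n] mult_mat_vec[of _ n n])
  have KTy: "(A * T) *\<^sub>v y = \<alpha> \<cdot>\<^sub>v (A *\<^sub>v y) + \<beta> \<cdot>\<^sub>v (A *\<^sub>v x)"
    using Ac T xy
    by (simp add: assoc_mult_mat_vec[of _ n n _ n] Ty mult_add_distrib_mat_vec[of _ n n] mult_mat_vec[of _ n n])
  have Axy: "A *\<^sub>v x \<in> carrier_vec n" "A *\<^sub>v y \<in> carrier_vec n" using Ac xy by auto
  have "((A * T) *\<^sub>v x) \<bullet> y = ((A * T) *\<^sub>v y) \<bullet> x"
    by (rule sym_mat_scalar_prod[OF K xy])
  then have "\<alpha> * ((A *\<^sub>v x) \<bullet> y) - \<beta> * quad_form A y = \<alpha> * ((A *\<^sub>v y) \<bullet> x) + \<beta> * quad_form A x"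
    unfolding KTx KTy quad_form_def using xy Axy
    by (simp add: minus_scalar_prod_distrib[of _ n] add_scalar_prod_distrib[of _ n])
  then have "\<beta> * (quad_form A x + quad_form A y) = 0"
    using sym_mat_scalar_prod[OF spd_sym_mat[OF A] xy] by (simp add: distrib_left)
  moreover have "quad_form A x + quad_form A y > 0"
    using ne spd_quad_form_pos[OF A xy(1)] spd_quad_form_pos[OF A xy(2)]
      spd_quad_form_nonneg[OF A xy(1)] spd_quad_form_nonneg[OF A xy(2)] by linarith
  ultimately have \<beta>: "\<beta> = 0" by simp
  then show "z \<in> \<real>" by (simp add: \<beta>_def complex_is_Real_iff)
  have "T *\<^sub>v x = \<alpha> \<cdot>\<^sub>v x" "T *\<^sub>v y = \<alpha> \<cdot>\<^sub>v y"
    unfolding Tx Ty \<beta> using xy by auto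
  then show "eigenvalue T (Re z)"
    using ne xy T unfolding eigenvalue_def eigenvector_def \<alpha>_def by auto
qed

text \<open>The vector \<open>p(T) v\<close> by Horner's scheme. Working over an arbitrary field allows the polynomial to
  be split into linear factors over the complex numbers.\<close>

definition poly_vec :: "'a::field mat \<Rightarrow> 'a poly \<Rightarrow> 'a vec \<Rightarrow> 'a vec" where
  "poly_vec T p v = fold_coeffs (\<lambda>a w. a \<cdot>\<^sub>v v + T *\<^sub>v w) p (0\<^sub>v (dim_vec v))"

context
  fixes T :: "'a::field mat" and n :: nat and v :: "'a vec"
  assumes T: "T \<in> carrier_mat n n" and v: "v \<in> carrier_vec n"
begin

lemma poly_vec_0 [simp]: "poly_vec T 0 v = 0\<^sub>v n"
  using v by (simp add: poly_vec_def)

lemma poly_vec_pCons: "poly_vec T (pCons a p) v = a \<cdot>\<^sub>v v + T *\<^sub>v poly_vec T p v"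
proof (cases "a = 0 \<and> p = 0")
  case True
  then show ?thesis using T v by (intro eq_vecI) (auto simp: poly_vec_def)
next
  case False
  then show ?thesis by (auto simp: poly_vec_def)
qed

lemma poly_vec_carrier [simp]: "poly_vec T p v \<in> carrier_vec n"
  by (induction p) (use T v in \<open>auto simp: poly_vec_pCons\<close>)

lemma poly_vec_add: "poly_vec T (p + q) v = poly_vec T p v + poly_vec T q v"
proof (induction p q rule: poly_induct2)
  case 0
  then show ?case by simp
next
  case (pCons a p b q)
  have [simp]: "T *\<^sub>v poly_vec T r v \<in> carrier_vec n" for r using T by (intro mult_mat_vec_carrier) auto
  show ?case
    unfolding add_pCons poly_vec_pCons pCons
    using v T poly_vec_carrier[of p] poly_vec_carrier[of q]
    by (intro eq_vecI) (auto simp: mult_add_distrib_mat_vec[of _ n n] add_smult_distrib_vec algebra_simps)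
qed

lemma poly_vec_smult: "poly_vec T (Polynomial.smult c p) v = c \<cdot>\<^sub>v poly_vec T p v"
proof (induction p)
  case (pCons a p)
  have [simp]: "T *\<^sub>v poly_vec T r v \<in> carrier_vec n" for r using T by (intro mult_mat_vec_carrier) auto
  show ?case
    unfolding smult_pCons poly_vec_pCons pCons
    using v T poly_vec_carrier[of p]
    by (simp add: mult_mat_vec[of _ n n] smult_add_distrib_vec[of _ n] smult_smult_assoc)
qed auto

lemma poly_vec_linear_factor:
  "poly_vec T ([:- z, 1:] * p) v = T *\<^sub>v poly_vec T p v - z \<cdot>\<^sub>v poly_vec T p v"
proof -
  have *: "[:- z, 1:] * p = Polynomial.smult (- z) p + pCons 0 p" by simp
  define u where "u = poly_vec T p v"
  have "u \<in> carrier_vec n" by (simp add: u_def)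
  then show ?thesis
    unfolding * poly_vec_add poly_vec_smult poly_vec_pCons u_def[symmetric]
    using v T by (intro eq_vecI) auto
qed

end

text \<open>Peel off linear factors of \<open>p\<close>. The first factor \<open>T - z\<close> that maps a nonzero vector to zero
  exhibits an eigenvector. For \<open>p = 0\<close> any eigenvalue will do.\<close>

lemma poly_vec_eq_0_imp_root:
  fixes T :: "complex mat"
  assumes T: "T \<in> carrier_mat n n" and v: "v \<in> carrier_vec n" "v \<noteq> 0\<^sub>v n"
    and "poly_vec T p v = 0\<^sub>v n"
  shows "\<exists>z. eigenvalue T z \<and> poly p z = 0"
  using \<open>poly_vec T p v = 0\<^sub>v n\<close>
proof (induction "degree p" arbitrary: p rule: less_induct)
  case less
  show ?case
  proof (cases "p = 0")
    case True
    have "n > 0" using v by (cases n) auto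
    with spectrum_non_empty[OF T] True show ?thesis by (auto simp: spectrum_def)
  next
    case False
    have "degree p \<noteq> 0"
    proof
      assume "degree p = 0"
      then obtain c where c: "p = [:c:]" by (rule degree_eq_zeroE)
      with less.prems have 0: "c \<cdot>\<^sub>v v + T *\<^sub>v 0\<^sub>v n = 0\<^sub>v n"
        using T v by (simp add: poly_vec_pCons)
      have "v $ i = 0" if "i < n" for i
        using arg_cong[OF 0, of "\<lambda>w. w $ i"] that T v(1) False c by (simp add: scalar_prod_def)
      then have "v = 0\<^sub>v n" using v(1) by (intro eq_vecI) auto
      with v(2) show False ..
    qed
    then have "\<not> constant (poly p)" by (simp add: constant_degree)
    then obtain z where z: "poly p z = 0" using fundamental_theorem_of_algebra by blast
    then obtain r where r: "p = [:- z, 1:] * r" by (auto simp: poly_eq_0_iff_dvd)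
    with False have "r \<noteq> 0" by auto
    then have deg: "degree r < degree p" unfolding r by (subst degree_mult_eq) auto
    show ?thesis
    proof (cases "poly_vec T r v = 0\<^sub>v n")
      case True
      from less.hyps[OF deg True] show ?thesis by (auto simp: r)
    next
      case r0: False
      let ?u = "poly_vec T r v"
      have u: "?u \<in> carrier_vec n" using T v by simp
      have 0: "T *\<^sub>v ?u - z \<cdot>\<^sub>v ?u = 0\<^sub>v n"
        using less.prems poly_vec_linear_factor[OF T v(1)] r by simp
      have "(T *\<^sub>v ?u) $ i = (z \<cdot>\<^sub>v ?u) $ i" if "i < n" for i
        using arg_cong[OF 0, of "\<lambda>w. w $ i"] that T u by simp
      then have "T *\<^sub>v ?u = z \<cdot>\<^sub>v ?u" using T u by (intro eq_vecI) auto
      then have "eigenvalue T z" using r0 u T unfolding eigenvalue_def eigenvector_def by auto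
      with z show ?thesis by blast
    qed
  qed
qed

lemma poly_of_mat_carrier [simp]: "T \<in> carrier_mat n n \<Longrightarrow> poly_of_mat p T \<in> carrier_mat n n"
  by (simp add: poly_of_mat_def)

lemma dim_poly_of_mat [simp]: "dim_row (poly_of_mat p T) = dim_row T" "dim_col (poly_of_mat p T) = dim_row T"
  by (simp_all add: poly_of_mat_def)

lemma poly_of_mat_0: "T \<in> carrier_mat n n \<Longrightarrow> poly_of_mat 0 T = 0\<^sub>m n n"
  by (intro eq_matI) (auto simp: poly_of_mat_def)

lemma poly_of_mat_pCons:
  assumes T: "T \<in> carrier_mat n n"
  shows "poly_of_mat (pCons a p) T = a \<cdot>\<^sub>m 1\<^sub>m n + poly_of_mat p T * T"
proof (cases "p = 0")
  case True
  then show ?thesis using T by (intro eq_matI) (auto simp: poly_of_mat_def poly_of_mat_0[OF T] scalar_prod_def)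
next
  case False
  show ?thesis
  proof (rule eq_matI)
    fix i j assume "i < dim_row (a \<cdot>\<^sub>m 1\<^sub>m n + poly_of_mat p T * T)" "j < dim_col (a \<cdot>\<^sub>m 1\<^sub>m n + poly_of_mat p T * T)"
    then have ij: "i < n" "j < n" using T by (auto simp: poly_of_mat_def)
    have pc: "T ^\<^sub>m k \<in> carrier_mat n n" for k using T by (rule pow_carrier_mat)
    have "poly_of_mat (pCons a p) T $$ (i, j) =
        (\<Sum>k\<le>Suc (degree p). coeff (pCons a p) k * (T ^\<^sub>m k) $$ (i, j))"
      using T ij False by (simp add: poly_of_mat_def)
    also have "\<dots> = a * 1\<^sub>m n $$ (i, j) + (\<Sum>k\<le>degree p. coeff p k * (T ^\<^sub>m k * T) $$ (i, j))"
      using T by (subst sum.atMost_Suc_shift) simp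
    also have "(\<Sum>k\<le>degree p. coeff p k * (T ^\<^sub>m k * T) $$ (i, j)) =
        (\<Sum>k\<le>degree p. \<Sum>l<n. coeff p k * (T ^\<^sub>m k) $$ (i, l) * T $$ (l, j))"
      using T ij pc by (intro sum.cong refl)
        (simp add: scalar_prod_def sum_distrib_left atLeast0LessThan mult.assoc carrier_matD[OF pc])
    also have "\<dots> = (poly_of_mat p T * T) $$ (i, j)"
      using T ij by (subst sum.swap)
        (simp add: scalar_prod_def atLeast0LessThan poly_of_mat_def sum_distrib_right)
    finally show "poly_of_mat (pCons a p) T $$ (i, j) = (a \<cdot>\<^sub>m 1\<^sub>m n + poly_of_mat p T * T) $$ (i, j)"
      using ij T by simp
  qed (use T in \<open>auto simp: poly_of_mat_def\<close>)
qed

lemma poly_of_mat_commute: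
  assumes T: "T \<in> carrier_mat n n"
  shows "poly_of_mat p T * T = T * poly_of_mat p T"
proof (induction p)
  case 0
  then show ?case using T by (simp add: poly_of_mat_0)
next
  case (pCons a p)
  let ?P = "poly_of_mat p T"
  have P: "?P \<in> carrier_mat n n" using T by simp
  have "a \<cdot>\<^sub>m 1\<^sub>m n * T = T * (a \<cdot>\<^sub>m 1\<^sub>m n)"
    using T mult_smult_distrib[OF T one_carrier_mat] by (simp add: mult_smult_assoc_mat[of _ n n])
  moreover have "?P * T * T = T * (?P * T)"
    using assoc_mult_mat[OF T P T] pCons(2) by simp
  moreover have 1: "a \<cdot>\<^sub>m 1\<^sub>m n \<in> carrier_mat n n" "?P * T \<in> carrier_mat n n" using T P by auto
  ultimately show ?case
    unfolding poly_of_mat_pCons[OF T] add_mult_distrib_mat[OF 1 T] mult_add_distrib_mat[OF T 1] by simp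
qed

lemma poly_of_mat_mult_vec_complex:
  assumes T: "T \<in> carrier_mat n n" and v: "v \<in> carrier_vec n"
  shows "map_vec complex_of_real (poly_of_mat p T *\<^sub>v v) =
    poly_vec (map_mat complex_of_real T) (map_poly complex_of_real p) (map_vec complex_of_real v)"
proof (induction p)
  case 0
  show ?case using T v by (intro eq_vecI) (auto simp: poly_of_mat_0 scalar_prod_def)
next
  case (pCons a p)
  have T': "map_mat complex_of_real T \<in> carrier_mat n n" and v': "map_vec complex_of_real v \<in> carrier_vec n"
    using T v by auto
  have pv: "poly_of_mat p T *\<^sub>v v \<in> carrier_vec n" by (rule mult_mat_vec_carrier[OF poly_of_mat_carrier[OF T] v])
  have "poly_of_mat (pCons a p) T *\<^sub>v v = a \<cdot>\<^sub>v v + T *\<^sub>v (poly_of_mat p T *\<^sub>v v)"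
    using T v poly_of_mat_carrier[OF T, of p]
    by (simp add: poly_of_mat_pCons poly_of_mat_commute add_mult_distrib_mat_vec[of _ n n] smult_mat_mult_vec[of _ n n]
         assoc_mult_mat_vec[of _ n n _ n])
  also have "map_vec complex_of_real \<dots> = of_real a \<cdot>\<^sub>v map_vec of_real v + map_mat of_real T *\<^sub>v map_vec of_real (poly_of_mat p T *\<^sub>v v)"
    using of_real_hom.mult_mat_vec_hom[OF T pv, where 'a = complex] T v pv
    by (intro eq_vecI) (auto simp flip: of_real_hom.mult_mat_vec_hom)
  finally show ?case
    by (simp add: pCons poly_vec_pCons[OF T' v'] of_real_hom.map_poly_pCons_hom)
qed

text \<open>If \<open>p(T) v = s v\<close> then \<open>(p - s)(T)\<close> annihilates \<open>v\<close>, hence \<open>p - s\<close> has a root among the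
  complex eigenvalues of \<open>T\<close>, and those are real because \<open>T\<close> is self-adjoint with respect to \<open>A\<close>.\<close>

lemma eigenvalue_poly_of_mat:
  assumes A: "spd n A" and T: "T \<in> carrier_mat n n" and K: "sym_mat n (A * T)"
    and s: "eigenvalue (poly_of_mat p T) s"
  obtains t where "eigenvalue T t" "poly p t = s"
proof -
  obtain v where v: "v \<in> carrier_vec n" "v \<noteq> 0\<^sub>v n" "poly_of_mat p T *\<^sub>v v = s \<cdot>\<^sub>v v"
    using s T by (auto simp: eigenvalue_def eigenvector_def)
  let ?T = "map_mat complex_of_real T" and ?v = "map_vec complex_of_real v"
  let ?q = "map_poly complex_of_real p + [:- complex_of_real s:]"
  have T': "?T \<in> carrier_mat n n" and v': "?v \<in> carrier_vec n" using T v by auto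
  have v0: "?v \<noteq> 0\<^sub>v n"
  proof
    assume 0: "?v = 0\<^sub>v n"
    have "v $ i = 0" if "i < n" for i
      using arg_cong[OF 0, of "\<lambda>w. w $ i"] that v(1) by simp
    then have "v = 0\<^sub>v n" using v(1) by (intro eq_vecI) auto
    with v(2) show False ..
  qed
  have "poly_vec ?T ?q ?v = map_vec complex_of_real (s \<cdot>\<^sub>v v) + ((- of_real s) \<cdot>\<^sub>v ?v + ?T *\<^sub>v 0\<^sub>v n)"
    using poly_of_mat_mult_vec_complex[OF T v(1), of p] v(3)
    by (simp add: poly_vec_add[OF T' v'] poly_vec_pCons[OF T' v'] poly_vec_0[OF T' v'])
  also have "\<dots> = 0\<^sub>v n"
    using v(1) T by (intro eq_vecI) (auto simp: scalar_prod_def)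
  finally obtain z where z: "eigenvalue ?T z" "poly ?q z = 0"
    using poly_vec_eq_0_imp_root[OF T' v' v0] by blast
  note re = complex_eigenvalue_pencil_real[OF A T K z(1)]
  then have "z = of_real (Re z)" by (simp add: complex_is_Real_iff complex_eq_iff)
  then have "poly ?q (of_real (Re z)) = 0" using z(2) by simp
  then have "poly p (Re z) = s"
    by (simp add: of_real_hom.poly_map_poly flip: of_real_minus of_real_add)
  with re(2) that show thesis by blast
qed

text \<open>Polynomials in \<open>T\<close> inherit from \<open>T\<close> that they are self-adjoint in the \<open>A\<close>-inner product.\<close>

lemma sym_mat_mult_poly_of_mat:
  assumes Ac: "A \<in> carrier_mat n n" and AT: "A\<^sup>T = A" and T: "T \<in> carrier_mat n n" and K: "sym_mat n (A * T)"
  shows "sym_mat n (A * poly_of_mat p T)"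
proof -
  have TA: "T\<^sup>T * A = A * T"
    using K transpose_mult[OF Ac T] AT by (simp add: sym_mat_def)
  have "(poly_of_mat p T)\<^sup>T * A = A * poly_of_mat p T"
  proof (induction p)
    case 0
    then show ?case using Ac T by (simp add: poly_of_mat_0)
  next
    case (pCons a p)
    let ?P = "poly_of_mat p T"
    have P: "?P \<in> carrier_mat n n" using T by simp
    have 1: "a \<cdot>\<^sub>m 1\<^sub>m n \<in> carrier_mat n n" "?P * T \<in> carrier_mat n n" "T\<^sup>T * ?P\<^sup>T \<in> carrier_mat n n"
      using T P by auto
    have scaled_one: "(a \<cdot>\<^sub>m 1\<^sub>m n)\<^sup>T = a \<cdot>\<^sub>m 1\<^sub>m n" by (intro eq_matI) auto
    have "(T\<^sup>T * ?P\<^sup>T) * A = T\<^sup>T * (?P\<^sup>T * A)" using Ac T P by (intro assoc_mult_mat[of _ n n _ n _ n]) auto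
    also have "\<dots> = (T\<^sup>T * A) * ?P" unfolding pCons using Ac T P by (intro assoc_mult_mat[of _ n n _ n _ n, symmetric]) auto
    also have "\<dots> = A * (?P * T)" unfolding TA poly_of_mat_commute[OF T] using Ac T P by (intro assoc_mult_mat[of _ n n _ n _ n]) auto
    finally have 2: "(T\<^sup>T * ?P\<^sup>T) * A = A * (?P * T)" .
    have "(poly_of_mat (pCons a p) T)\<^sup>T = a \<cdot>\<^sub>m 1\<^sub>m n + T\<^sup>T * ?P\<^sup>T"
      unfolding poly_of_mat_pCons[OF T] transpose_add[OF 1(1,2)] transpose_mult[OF P T] scaled_one ..
    then show ?case
      using 2 Ac mult_smult_distrib[OF Ac one_carrier_mat] mult_smult_assoc_mat[OF one_carrier_mat Ac]
      by (simp add: poly_of_mat_pCons[OF T] add_mult_distrib_mat[OF 1(1,3) Ac] mult_add_distrib_mat[OF Ac 1(1,2)] del: assoc_mult_mat)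
  qed
  then show ?thesis
    using Ac T AT by (simp add: sym_mat_def transpose_mult[OF Ac poly_of_mat_carrier[OF T]])
qed

section \<open>Eigenvalue bounds and form bounds\<close>

lemma quad_form_ge_of_pencil:
  assumes A: "spd n A" and K: "sym_mat n K"
    and ge: "\<And>s v. v \<in> carrier_vec n \<Longrightarrow> v \<noteq> 0\<^sub>v n \<Longrightarrow> K *\<^sub>v v = s \<cdot>\<^sub>v (A *\<^sub>v v) \<Longrightarrow> m \<le> s"
    and v: "v \<in> carrier_vec n"
  shows "m * quad_form A v \<le> quad_form K v"
proof (cases "n = 0")
  case True
  then show ?thesis using A K v by (simp add: quad_form_def scalar_prod_def sym_mat_def spd_def)
next
  case False
  then obtain s u where "u \<in> carrier_vec n" "u \<noteq> 0\<^sub>v n" "K *\<^sub>v u = s \<cdot>\<^sub>v (A *\<^sub>v u)"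
    and s: "\<And>w. w \<in> carrier_vec n \<Longrightarrow> s * quad_form A w \<le> quad_form K w"
    using pencil_smallest_eigenvalue[OF _ A K] by blast
  then have "m \<le> s" by (intro ge)
  then have "m * quad_form A v \<le> s * quad_form A v"
    using spd_quad_form_nonneg[OF A v] by (rule mult_right_mono)
  with s[OF v] show ?thesis by simp
qed

lemma eigenvalue_of_pencil:
  assumes A: "spd n A" and T: "T \<in> carrier_mat n n"
    and v: "v \<in> carrier_vec n" "v \<noteq> 0\<^sub>v n" and eq: "(A * T) *\<^sub>v v = s \<cdot>\<^sub>v (A *\<^sub>v v)"
  shows "eigenvalue T s"
proof -
  have Ac: "A \<in> carrier_mat n n" using A by (simp add: spd_def)
  have Tv: "T *\<^sub>v v \<in> carrier_vec n" using T v by simp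
  have "A *\<^sub>v (T *\<^sub>v v - s \<cdot>\<^sub>v v) = (A * T) *\<^sub>v v - s \<cdot>\<^sub>v (A *\<^sub>v v)"
    using Ac T v Tv by (simp add: mult_minus_distrib_mat_vec[of _ n n] mult_mat_vec[of _ n n])
  also have "\<dots> = 0\<^sub>v n" unfolding eq using Ac v by (intro eq_vecI) auto
  finally have "A *\<^sub>v (T *\<^sub>v v - s \<cdot>\<^sub>v v) = 0\<^sub>v n" .
  with Tv v have 0: "T *\<^sub>v v - s \<cdot>\<^sub>v v = 0\<^sub>v n" using spd_kernel[OF A] by simp
  have "(T *\<^sub>v v) $ i = (s \<cdot>\<^sub>v v) $ i" if "i < n" for i
    using arg_cong[OF 0, of "\<lambda>w. w $ i"] that T v(1) by simp
  then have "T *\<^sub>v v = s \<cdot>\<^sub>v v" using T v(1) by (intro eq_vecI) auto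
  then show ?thesis using v T unfolding eigenvalue_def eigenvector_def by auto
qed

text \<open>The lower bound is the smallest Rayleigh quotient of the pencil \<open>(A T, A)\<close>; the upper bound is
  the lower bound for \<open>- A T\<close>.\<close>

lemma quad_form_bounds_of_eigenvalues:
  assumes A: "spd n A" and T: "T \<in> carrier_mat n n" and K: "sym_mat n (A * T)"
    and ev: "\<forall>s. eigenvalue T s \<longrightarrow> m \<le> s \<and> s \<le> M" and v: "v \<in> carrier_vec n"
  shows "m * quad_form A v \<le> quad_form (A * T) v" "quad_form (A * T) v \<le> M * quad_form A v"
proof -
  have Kc: "A * T \<in> carrier_mat n n" using K by (rule sym_mat_carrier)
  show "m * quad_form A v \<le> quad_form (A * T) v"
    using eigenvalue_of_pencil[OF A T] ev by (intro quad_form_ge_of_pencil[OF A K _ v]) blast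
  have K': "sym_mat n (- 1 \<cdot>\<^sub>m (A * T))" using K by (rule sym_mat_smult)
  have "- M * quad_form A v \<le> quad_form (- 1 \<cdot>\<^sub>m (A * T)) v"
  proof (rule quad_form_ge_of_pencil[OF A K' _ v])
    fix s u assume u: "u \<in> carrier_vec n" "u \<noteq> 0\<^sub>v n" and "- 1 \<cdot>\<^sub>m (A * T) *\<^sub>v u = s \<cdot>\<^sub>v (A *\<^sub>v u)"
    then have *: "- 1 \<cdot>\<^sub>v ((A * T) *\<^sub>v u) = s \<cdot>\<^sub>v (A *\<^sub>v u)"
      using Kc by (simp add: smult_mat_mult_vec[of _ n n])
    have "(A * T) *\<^sub>v u = - 1 \<cdot>\<^sub>v (- 1 \<cdot>\<^sub>v ((A * T) *\<^sub>v u))" by (simp add: smult_smult_assoc)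
    also have "\<dots> = (- s) \<cdot>\<^sub>v (A *\<^sub>v u)" unfolding * by (simp add: smult_smult_assoc)
    finally have "eigenvalue T (- s)" by (rule eigenvalue_of_pencil[OF A T u])
    with ev show "- M \<le> s" by fastforce
  qed
  then show "quad_form (A * T) v \<le> M * quad_form A v"
    using Kc v by (simp add: quad_form_smult)
qed

lemma quad_form_poly_of_mat_bounds:
  assumes A: "spd n A" and T: "T \<in> carrier_mat n n" and K: "sym_mat n (A * T)"
    and ev: "\<forall>s. eigenvalue T s \<longrightarrow> m \<le> poly p s \<and> poly p s \<le> M" and v: "v \<in> carrier_vec n"
  shows "m * quad_form A v \<le> quad_form (A * poly_of_mat p T) v"
    "quad_form (A * poly_of_mat p T) v \<le> M * quad_form A v"
proof -
  have sym: "sym_mat n (A * poly_of_mat p T)"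
    using A T K by (intro sym_mat_mult_poly_of_mat) (auto simp: spd_def)
  have "\<forall>s. eigenvalue (poly_of_mat p T) s \<longrightarrow> m \<le> s \<and> s \<le> M"
    using eigenvalue_poly_of_mat[OF A T K] ev by metis
  note quad_form_bounds_of_eigenvalues[OF A poly_of_mat_carrier[OF T] sym this v]
  then show "m * quad_form A v \<le> quad_form (A * poly_of_mat p T) v"
    "quad_form (A * poly_of_mat p T) v \<le> M * quad_form A v" .
qed

section \<open>Congruence and inverses\<close>

lemma sym_mat_congruence:
  assumes C: "sym_mat m C" and E: "E \<in> carrier_mat m n"
  shows "sym_mat n (E\<^sup>T * C * E)"
proof -
  have Cc: "C \<in> carrier_mat m m" and CT: "C\<^sup>T = C" using C by (auto simp: sym_mat_def)
  have "(E\<^sup>T * C * E)\<^sup>T = E\<^sup>T * (E\<^sup>T * C)\<^sup>T" using E Cc by (intro transpose_mult[of _ n m]) auto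
  also have "(E\<^sup>T * C)\<^sup>T = C\<^sup>T * (E\<^sup>T)\<^sup>T" using E Cc by (intro transpose_mult[of _ n m]) auto
  finally have "(E\<^sup>T * C * E)\<^sup>T = E\<^sup>T * C * E"
    unfolding CT using E Cc by (simp add: assoc_mult_mat[of _ n m _ m _ n])
  then show ?thesis using E Cc by (simp add: sym_mat_def)
qed

lemma quad_form_congruence:
  assumes C: "C \<in> carrier_mat m m" and E: "E \<in> carrier_mat m n" and v: "v \<in> carrier_vec n"
  shows "quad_form (E\<^sup>T * C * E) v = quad_form C (E *\<^sub>v v)"
proof -
  have Ev: "E *\<^sub>v v \<in> carrier_vec m" using E v by simp
  have CEv: "C *\<^sub>v (E *\<^sub>v v) \<in> carrier_vec m" using C Ev by simp
  have "E\<^sup>T * C \<in> carrier_mat n m" "E\<^sup>T \<in> carrier_mat n m" using E C by auto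
  then have "(E\<^sup>T * C * E) *\<^sub>v v = E\<^sup>T *\<^sub>v (C *\<^sub>v (E *\<^sub>v v))"
    using E C v Ev by (simp add: assoc_mult_mat_vec[of _ n m _ n] assoc_mult_mat_vec[of _ n m _ m] del: assoc_mult_mat)
  then show ?thesis
    unfolding quad_form_def using transpose_vec_mult_scalar[OF E v CEv] by simp
qed

lemma spd_carrier: "spd n A \<Longrightarrow> A \<in> carrier_mat n n"
  by (simp add: spd_def)

lemma spd_inverse:
  assumes A: "spd n A"
  shows "mat_inv A \<in> carrier_mat n n" "A * mat_inv A = 1\<^sub>m n" "mat_inv A * A = 1\<^sub>m n"
  using mat_inv_of_trivial_kernel[OF spd_carrier[OF A] spd_kernel[OF A]] by blast+

lemma spd_sym_mat_inverse:
  assumes A: "spd n A"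
  shows "sym_mat n (mat_inv A)"
proof -
  let ?I = "mat_inv A"
  have Ac: "A \<in> carrier_mat n n" and AT: "A\<^sup>T = A" using A by (auto simp: spd_def)
  note inv = spd_inverse[OF A]
  have "?I\<^sup>T = ?I\<^sup>T * (A * ?I)" using inv by simp
  also have "\<dots> = (?I\<^sup>T * A) * ?I" using inv(1) Ac by (intro assoc_mult_mat[symmetric, of _ n n _ n _ n]) auto
  also have "?I\<^sup>T * A = (A * ?I)\<^sup>T" using transpose_mult[OF Ac inv(1)] AT by simp
  finally show ?thesis using inv by (simp add: sym_mat_def)
qed

lemma spd_inverse_mult_vec:
  assumes A: "spd n A" and v: "v \<in> carrier_vec n"
  shows "mat_inv A *\<^sub>v (A *\<^sub>v v) = v" "A *\<^sub>v (mat_inv A *\<^sub>v v) = v"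
  using assoc_mult_mat_vec[OF spd_inverse(1)[OF A] spd_carrier[OF A] v]
    assoc_mult_mat_vec[OF spd_carrier[OF A] spd_inverse(1)[OF A] v] spd_inverse(2,3)[OF A] v by auto

lemma quad_form_inverse:
  assumes A: "spd n A" and v: "v \<in> carrier_vec n"
  shows "quad_form (mat_inv A) (A *\<^sub>v v) = quad_form A v"
  unfolding quad_form_def spd_inverse_mult_vec[OF A v]
  using A v by (intro comm_scalar_prod[of _ n]) (auto simp: spd_def)

lemma preconditioned_pencil:
  assumes A: "spd n A" and B: "sym_mat n B"
  shows "sym_mat n (A * (B * A))"
    and "v \<in> carrier_vec n \<Longrightarrow> quad_form (A * (B * A)) v = quad_form B (A *\<^sub>v v)"
proof -
  have Ac: "A \<in> carrier_mat n n" and AT: "A\<^sup>T = A" using A by (auto simp: spd_def)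
  have Bc: "B \<in> carrier_mat n n" using B by (rule sym_mat_carrier)
  have *: "A * (B * A) = A\<^sup>T * B * A" unfolding AT using Ac Bc by simp
  show "sym_mat n (A * (B * A))" unfolding * by (rule sym_mat_congruence[OF B Ac])
  show "quad_form (A * (B * A)) v = quad_form B (A *\<^sub>v v)" if "v \<in> carrier_vec n"
    unfolding * by (rule quad_form_congruence[OF Bc Ac that])
qed

lemma eigenvalue_bounds_of_quad_form:
  assumes A: "spd n A" and T: "T \<in> carrier_mat n n"
    and le: "\<forall>v\<in>carrier_vec n.
      m * quad_form A v \<le> quad_form (A * T) v \<and> quad_form (A * T) v \<le> M * quad_form A v"
    and s: "eigenvalue T s"
  shows "m \<le> s \<and> s \<le> M"
proof -
  have Ac: "A \<in> carrier_mat n n" using A by (rule spd_carrier)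
  obtain v where v: "v \<in> carrier_vec n" "v \<noteq> 0\<^sub>v n" "T *\<^sub>v v = s \<cdot>\<^sub>v v"
    using s T by (auto simp: eigenvalue_def eigenvector_def)
  have "(A * T) *\<^sub>v v = s \<cdot>\<^sub>v (A *\<^sub>v v)"
    using assoc_mult_mat_vec[OF Ac T v(1)] v by (simp add: mult_mat_vec[OF Ac])
  then have "quad_form (A * T) v = s * quad_form A v"
    using Ac v(1) by (simp add: quad_form_def)
  then have "m * quad_form A v \<le> s * quad_form A v" "s * quad_form A v \<le> M * quad_form A v"
    using le v(1) by auto
  then show ?thesis using spd_quad_form_pos[OF A v(1,2)] by simp
qed

section \<open>The two-level operator\<close>

lemma invertible_mat_inverse:
  fixes X :: "real mat"
  assumes X: "X \<in> carrier_mat n n" and inv: "invertible_mat X"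
  shows "mat_inv X \<in> carrier_mat n n" "mat_inv X * X = 1\<^sub>m n"
proof -
  obtain Y where Y: "X * Y = 1\<^sub>m n" "Y * X = 1\<^sub>m (dim_row Y)"
    using inv X by (auto simp: invertible_mat_def inverts_mat_def)
  have "dim_row Y = n" using X arg_cong[OF Y(2), of dim_col] by simp
  moreover have "dim_col Y = n" using arg_cong[OF Y(1), of dim_col] by simp
  ultimately have Yc: "Y \<in> carrier_mat n n" by auto
  have "v = 0\<^sub>v n" if v: "v \<in> carrier_vec n" and 0: "X *\<^sub>v v = 0\<^sub>v n" for v
  proof -
    have "v = (Y * X) *\<^sub>v v" using Y(2) v \<open>dim_row Y = n\<close> by simp
    also have "\<dots> = Y *\<^sub>v 0\<^sub>v n" using assoc_mult_mat_vec[OF Yc X v] 0 by simp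
    also have "\<dots> = 0\<^sub>v n" using Yc by (intro eq_vecI) auto
    finally show ?thesis .
  qed
  from mat_inv_of_trivial_kernel[OF X this] show "mat_inv X \<in> carrier_mat n n" "mat_inv X * X = 1\<^sub>m n" by auto
qed

context
  fixes A M :: "real mat" and n :: nat
  assumes A: "spd n A" and M: "M \<in> carrier_mat n n" and inv: "invertible_mat M"
begin

lemma sym_mat_M_bar: "sym_mat n (M_bar A M)"
proof -
  note I = invertible_mat_inverse[OF M inv]
  have Ac: "A \<in> carrier_mat n n" and AT: "A\<^sup>T = A" using A by (auto simp: spd_def)
  let ?S = "mat_inv M + (mat_inv M)\<^sup>T"
  have S: "?S \<in> carrier_mat n n" using I by simp
  have "?S\<^sup>T = (mat_inv M)\<^sup>T + mat_inv M"
    using transpose_add[OF I(1), of "(mat_inv M)\<^sup>T"] I by simp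
  also have "\<dots> = ?S" using I by (intro comm_add_mat) auto
  finally have "(?S - A)\<^sup>T = ?S - A" using transpose_minus[OF S Ac] AT by simp
  then have "sym_mat n (?S - A)" using minus_carrier_mat[OF Ac] by (simp add: sym_mat_def)
  then show ?thesis unfolding M_bar_def by (rule sym_mat_congruence[OF _ M])
qed

text \<open>This is the identity \<open>I - M_bar A = (I - M\<^sup>T A) (I - M A)\<close> in the \<open>A\<close>-inner product: the form of
  \<open>M_bar\<close> is the energy removed by one smoothing step.\<close>

lemma quad_form_M_bar:
  assumes v: "v \<in> carrier_vec n"
  shows "quad_form (M_bar A M) (A *\<^sub>v v) = quad_form A v - quad_form A ((1\<^sub>m n - M * A) *\<^sub>v v)"
proof -
  note I = invertible_mat_inverse[OF M inv]
  have Ac: "A \<in> carrier_mat n n" using A by (rule spd_carrier)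
  define w where "w = A *\<^sub>v v"
  define z where "z = M *\<^sub>v w"
  have w: "w \<in> carrier_vec n" using Ac v by (simp add: w_def)
  have z: "z \<in> carrier_vec n" using M w by (simp add: z_def)
  have S: "mat_inv M + (mat_inv M)\<^sup>T \<in> carrier_mat n n" using I by simp
  have Iz: "mat_inv M *\<^sub>v z = w"
    unfolding z_def using assoc_mult_mat_vec[OF I(1) M w] I(2) w by simp
  have ITz: "((mat_inv M)\<^sup>T *\<^sub>v z) \<bullet> z = z \<bullet> w"
    using transpose_vec_mult_scalar[OF I(1) z z] Iz by simp
  have zw: "z \<bullet> w = w \<bullet> z" using z w by (rule comm_scalar_prod)
  have ITc: "(mat_inv M)\<^sup>T \<in> carrier_mat n n" using I by simp
  have "quad_form (M_bar A M) w = quad_form (mat_inv M + (mat_inv M)\<^sup>T - A) z"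
    unfolding M_bar_def z_def using S Ac w by (intro quad_form_congruence[OF _ M]) auto
  also have "\<dots> = quad_form (mat_inv M) z + quad_form ((mat_inv M)\<^sup>T) z - quad_form A z"
    using quad_form_minus[OF S Ac z] quad_form_add[OF I(1) ITc z] by simp
  also have "\<dots> = 2 * (w \<bullet> z) - quad_form A z"
    using Iz ITz zw by (simp add: quad_form_def)
  finally have 1: "quad_form (M_bar A M) w = 2 * (w \<bullet> z) - quad_form A z" .
  have "(1\<^sub>m n - M * A) *\<^sub>v v = 1\<^sub>m n *\<^sub>v v - (M * A) *\<^sub>v v"
    using M Ac v by (intro minus_mult_distrib_mat_vec[of _ n n]) auto
  also have "\<dots> = v - z" using assoc_mult_mat_vec[OF M Ac v] v by (simp add: z_def w_def)
  finally have 2: "(1\<^sub>m n - M * A) *\<^sub>v v = v - z" .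
  have Az: "A *\<^sub>v z \<in> carrier_vec n" using Ac z by simp
  have "(A *\<^sub>v z) \<bullet> v = w \<bullet> z"
    using sym_mat_scalar_prod[OF spd_sym_mat[OF A] z v] by (simp add: w_def)
  then have "quad_form A (v - z) = quad_form A v - 2 * (w \<bullet> z) + quad_form A z"
    unfolding quad_form_def mult_minus_distrib_mat_vec[OF Ac v z]
    using v w z Az
    by (simp add: minus_scalar_prod_distrib[of _ n] scalar_prod_minus_distrib[of _ n] flip: w_def)
  with 1 2 show ?thesis by (simp add: w_def)
qed

lemma nonexpansive_quad_form_le:
  assumes ne: "energy_opnorm A (1\<^sub>m n - M * A) \<le> 1" and v: "v \<in> carrier_vec n"
  shows "quad_form A ((1\<^sub>m n - M * A) *\<^sub>v v) \<le> quad_form A v"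
proof (cases "v = 0\<^sub>v n")
  case True
  have "(1\<^sub>m n - M * A) *\<^sub>v v = 0\<^sub>v n"
    using True M spd_carrier[OF A] by (intro eq_vecI) (auto simp: scalar_prod_def)
  with True show ?thesis by simp
next
  case False
  have pos: "quad_form A v > 0" by (rule spd_quad_form_pos[OF A v False])
  have Ac: "A \<in> carrier_mat n n" using A by (rule spd_carrier)
  have "ereal (energy_norm A ((1\<^sub>m n - M * A) *\<^sub>v v) / energy_norm A v) \<le> energy_opnorm A (1\<^sub>m n - M * A)"
    unfolding energy_opnorm_def using v False Ac by (intro SUP_upper) auto
  also note ne
  finally have "energy_norm A ((1\<^sub>m n - M * A) *\<^sub>v v) / energy_norm A v \<le> 1" by (simp flip: one_ereal_def)
  then show ?thesis using pos by (simp add: energy_norm_def quad_form_def)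
qed

lemma quad_form_M_bar_nonneg:
  assumes "energy_opnorm A (1\<^sub>m n - M * A) \<le> 1" and w: "w \<in> carrier_vec n"
  shows "quad_form (M_bar A M) w \<ge> 0"
proof -
  have "mat_inv A *\<^sub>v w \<in> carrier_vec n" using spd_inverse(1)[OF A] w by simp
  from quad_form_M_bar[OF this] nonexpansive_quad_form_le[OF assms(1) this]
  show ?thesis by (simp add: spd_inverse_mult_vec[OF A w])
qed

context
  fixes P :: "real mat" and m :: nat
  assumes P: "P \<in> carrier_mat n m"
begin

text \<open>Since \<open>I - M\<^sup>T A\<close> is the transpose of \<open>I - A M\<close>, the coarse correction is a congruence transform
  of the coarse operator, hence monotone in it.\<close>

lemma two_level_op_eq:
  assumes C: "C \<in> carrier_mat m m"
  shows "two_level_op A M P C =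
    M_bar A M + (P\<^sup>T * (1\<^sub>m n - A * M))\<^sup>T * C * (P\<^sup>T * (1\<^sub>m n - A * M))"
proof -
  have Ac: "A \<in> carrier_mat n n" and AT: "A\<^sup>T = A" using A by (auto simp: spd_def)
  let ?F = "1\<^sub>m n - A * M"
  have AM: "A * M \<in> carrier_mat n n" using Ac M by simp
  then have F: "?F \<in> carrier_mat n n" by (rule minus_carrier_mat)
  have "?F\<^sup>T = 1\<^sub>m n - M\<^sup>T * A"
    using transpose_minus[OF one_carrier_mat AM] transpose_mult[OF Ac M] AT by simp
  moreover have "(P\<^sup>T * ?F)\<^sup>T = ?F\<^sup>T * P"
    using transpose_mult[OF _ F, of "P\<^sup>T" m] P by simp
  ultimately have E: "(1\<^sub>m n - M\<^sup>T * A) * P = (P\<^sup>T * ?F)\<^sup>T" by simp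
  have "(1\<^sub>m n - M\<^sup>T * A) * P * C * P\<^sup>T * ?F = (P\<^sup>T * ?F)\<^sup>T * C * (P\<^sup>T * ?F)"
    unfolding E using P C F mult_carrier_mat[OF _ F, of "P\<^sup>T" m]
    by (intro assoc_mult_mat[of _ n m _ n _ n]) (auto intro!: mult_carrier_mat[of _ n m])
  then show ?thesis using Ac by (simp add: two_level_op_def del: assoc_mult_mat)
qed

lemma sym_mat_two_level_op:
  assumes C: "sym_mat m C"
  shows "sym_mat n (two_level_op A M P C)"
proof -
  have Ac: "A \<in> carrier_mat n n" using A by (rule spd_carrier)
  have "P\<^sup>T * (1\<^sub>m n - A * M) \<in> carrier_mat m n" using P Ac M by auto
  from sym_mat_M_bar sym_mat_congruence[OF C this] show ?thesis
    unfolding two_level_op_eq[OF sym_mat_carrier[OF C]]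
    by (auto simp: sym_mat_def transpose_add[of _ n n])
qed

lemma quad_form_two_level_op:
  assumes C: "C \<in> carrier_mat m m" and w: "w \<in> carrier_vec n"
  shows "quad_form (two_level_op A M P C) w =
    quad_form (M_bar A M) w + quad_form C ((P\<^sup>T * (1\<^sub>m n - A * M)) *\<^sub>v w)"
proof -
  have Ac: "A \<in> carrier_mat n n" using A by (rule spd_carrier)
  have E: "P\<^sup>T * (1\<^sub>m n - A * M) \<in> carrier_mat m n" using P Ac M by auto
  have "(P\<^sup>T * (1\<^sub>m n - A * M))\<^sup>T * C * (P\<^sup>T * (1\<^sub>m n - A * M)) \<in> carrier_mat n n"
    using E C by auto
  then show ?thesis
    unfolding two_level_op_eq[OF C]
    using quad_form_congruence[OF C E w] quad_form_add[OF sym_mat_carrier[OF sym_mat_M_bar] _ w] by simp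
qed

text \<open>Scaling the smoothing part \<open>M_bar \<ge> 0\<close> by \<open>c \<le> 1\<close> decreases it and by \<open>d \<ge> 1\<close> increases it, so
  bounds for the coarse operators pass to the two-level operators with the same constants.\<close>

lemma two_level_op_compare:
  assumes ne: "energy_opnorm A (1\<^sub>m n - M * A) \<le> 1"
    and C: "C \<in> carrier_mat m m" and D: "D \<in> carrier_mat m m"
    and le: "\<forall>y\<in>carrier_vec m. c * quad_form D y \<le> quad_form C y \<and> quad_form C y \<le> d * quad_form D y"
    and c: "c \<le> 1" and d: "1 \<le> d" and w: "w \<in> carrier_vec n"
  shows "c * quad_form (two_level_op A M P D) w \<le> quad_form (two_level_op A M P C) w"
    and "quad_form (two_level_op A M P C) w \<le> d * quad_form (two_level_op A M P D) w"
proof -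
  define y where "y = (P\<^sup>T * (1\<^sub>m n - A * M)) *\<^sub>v w"
  have "P\<^sup>T * (1\<^sub>m n - A * M) \<in> carrier_mat m n" using P spd_carrier[OF A] M by auto
  then have "y \<in> carrier_vec m" unfolding y_def using w by (rule mult_mat_vec_carrier)
  note le = le[rule_format, OF this]
  have "quad_form (M_bar A M) w \<ge> 0" by (rule quad_form_M_bar_nonneg[OF ne w])
  then have "c * quad_form (M_bar A M) w \<le> 1 * quad_form (M_bar A M) w"
    "1 * quad_form (M_bar A M) w \<le> d * quad_form (M_bar A M) w"
    using c d by (intro mult_right_mono; simp)+
  with le show "c * quad_form (two_level_op A M P D) w \<le> quad_form (two_level_op A M P C) w"
    "quad_form (two_level_op A M P C) w \<le> d * quad_form (two_level_op A M P D) w"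
    unfolding quad_form_two_level_op[OF C w] quad_form_two_level_op[OF D w] y_def[symmetric] distrib_left
    by simp_all
qed

end

end

section \<open>Spectral bounds through the levels\<close>

text \<open>The relation \<open>c A\<^sup>-\<^sup>1 \<le> B \<le> d A\<^sup>-\<^sup>1\<close>, tested on vectors \<open>A v\<close> so that no inverse appears.\<close>

definition preconditioner_bounds :: "nat \<Rightarrow> real mat \<Rightarrow> real mat \<Rightarrow> real \<Rightarrow> real \<Rightarrow> bool" where
  "preconditioner_bounds n A B c d \<longleftrightarrow> sym_mat n B \<and>
     (\<forall>v\<in>carrier_vec n. c * quad_form A v \<le> quad_form B (A *\<^sub>v v) \<and>
                        quad_form B (A *\<^sub>v v) \<le> d * quad_form A v)"

lemma preconditioner_bounds_eigenvalue:
  assumes A: "spd n A" and B: "preconditioner_bounds n A B c d" and s: "eigenvalue (B * A) s"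
  shows "c \<le> s \<and> s \<le> d"
proof -
  have sym: "sym_mat n B" using B by (simp add: preconditioner_bounds_def)
  have T: "B * A \<in> carrier_mat n n" using sym_mat_carrier[OF sym] spd_carrier[OF A] by simp
  show ?thesis
    using B by (intro eigenvalue_bounds_of_quad_form[OF A T _ s])
      (auto simp: preconditioner_bounds_def preconditioned_pencil(2)[OF A sym])
qed

lemma preconditioner_bounds_inverse:
  assumes A: "spd n A" and "c \<le> 1" "1 \<le> d"
  shows "preconditioner_bounds n A (mat_inv A) c d"
proof -
  have "c * quad_form A v \<le> 1 * quad_form A v" "1 * quad_form A v \<le> d * quad_form A v"
    if "v \<in> carrier_vec n" for v
    using assms(2,3) spd_quad_form_nonneg[OF A that] by (intro mult_right_mono; simp)+
  then show ?thesis
    unfolding preconditioner_bounds_def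
    using spd_sym_mat_inverse[OF A] by (simp add: quad_form_inverse[OF A])
qed

text \<open>On a vector \<open>A v\<close> the form of \<open>(I - p(B A)) A\<^sup>-\<^sup>1\<close> is \<open>(A v, v) - (A p(B A) v, v)\<close>, and spectral
  mapping bounds the last term by the values of \<open>p\<close> on \<open>[m, M]\<close>.\<close>

lemma preconditioner_bounds_poly_acceleration:
  assumes A: "spd n A" and B: "preconditioner_bounds n A B m M"
    and p: "\<forall>x. m \<le> x \<longrightarrow> x \<le> M \<longrightarrow> c \<le> 1 - poly p x \<and> 1 - poly p x \<le> d"
  shows "preconditioner_bounds n A ((1\<^sub>m n - poly_of_mat p (B * A)) * mat_inv A) c d"
proof -
  let ?T = "B * A" and ?I = "mat_inv A"
  let ?Q = "poly_of_mat p ?T"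
  have Ac: "A \<in> carrier_mat n n" using A by (rule spd_carrier)
  have sym: "sym_mat n B" using B by (simp add: preconditioner_bounds_def)
  have T: "?T \<in> carrier_mat n n" using sym_mat_carrier[OF sym] Ac by simp
  have Q: "?Q \<in> carrier_mat n n" using T by simp
  have F: "1\<^sub>m n - ?Q \<in> carrier_mat n n" using Q by (rule minus_carrier_mat)
  note I = spd_inverse[OF A]
  have II: "?I\<^sup>T = ?I" using spd_sym_mat_inverse[OF A] by (simp add: sym_mat_def)
  note K = preconditioned_pencil(1)[OF A sym]
  have AQ: "sym_mat n (A * ?Q)"
    using A by (intro sym_mat_mult_poly_of_mat[OF _ _ T K]) (auto simp: spd_def)
  have "A * (1\<^sub>m n - ?Q) = A - A * ?Q"
    using mult_minus_distrib_mat[OF Ac one_carrier_mat Q] Ac by simp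
  then have "sym_mat n (A * (1\<^sub>m n - ?Q))"
    using sym_mat_minus[OF spd_sym_mat[OF A] AQ] by metis
  \<comment> \<open>\<open>(I - p(B A)) A\<^sup>-\<^sup>1 = A\<^sup>-\<^sup>1 (A - A p(B A)) A\<^sup>-\<^sup>1\<close> is a congruence transform of a symmetric matrix\<close>
  from sym_mat_congruence[OF this I(1)] have "sym_mat n (?I * (A * (1\<^sub>m n - ?Q)) * ?I)"
    unfolding II .
  also have "?I * (A * (1\<^sub>m n - ?Q)) = 1\<^sub>m n - ?Q"
    using assoc_mult_mat[OF I(1) Ac F, symmetric] left_mult_one_mat[OF F] unfolding I(3)
    by (rule trans)
  finally have sym': "sym_mat n ((1\<^sub>m n - ?Q) * ?I)" .
  have qf: "quad_form ((1\<^sub>m n - ?Q) * ?I) (A *\<^sub>v v) = quad_form A v - quad_form (A * ?Q) v"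
    if v: "v \<in> carrier_vec n" for v
  proof -
    have Av: "A *\<^sub>v v \<in> carrier_vec n" and Qv: "?Q *\<^sub>v v \<in> carrier_vec n" using Ac Q v by auto
    have "((1\<^sub>m n - ?Q) * ?I) *\<^sub>v (A *\<^sub>v v) = (1\<^sub>m n - ?Q) *\<^sub>v v"
      using assoc_mult_mat_vec[OF F I(1) Av] spd_inverse_mult_vec(1)[OF A v] by simp
    also have "\<dots> = v - ?Q *\<^sub>v v"
      using minus_mult_distrib_mat_vec[OF one_carrier_mat Q v] v by simp
    finally have "quad_form ((1\<^sub>m n - ?Q) * ?I) (A *\<^sub>v v) = v \<bullet> (A *\<^sub>v v) - (?Q *\<^sub>v v) \<bullet> (A *\<^sub>v v)"
      unfolding quad_form_def using minus_scalar_prod_distrib[OF v Qv Av] by simp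
    also have "v \<bullet> (A *\<^sub>v v) = quad_form A v"
      unfolding quad_form_def by (rule comm_scalar_prod[OF v Av])
    also have "(?Q *\<^sub>v v) \<bullet> (A *\<^sub>v v) = (A *\<^sub>v v) \<bullet> (?Q *\<^sub>v v)" by (rule comm_scalar_prod[OF Qv Av])
    also have "\<dots> = (A *\<^sub>v (?Q *\<^sub>v v)) \<bullet> v" by (rule sym_mat_scalar_prod[OF spd_sym_mat[OF A] v Qv])
    also have "\<dots> = quad_form (A * ?Q) v"
      unfolding quad_form_def assoc_mult_mat_vec[OF Ac Q v] ..
    finally show ?thesis .
  qed
  have "\<forall>s. eigenvalue ?T s \<longrightarrow> 1 - d \<le> poly p s \<and> poly p s \<le> 1 - c"
    using p preconditioner_bounds_eigenvalue[OF A B] by (simp add: algebra_simps)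
  note bd = quad_form_poly_of_mat_bounds[OF A T K this]
  show ?thesis
    unfolding preconditioner_bounds_def
  proof (intro conjI ballI sym')
    fix v :: "real vec" assume v: "v \<in> carrier_vec n"
    show "c * quad_form A v \<le> quad_form ((1\<^sub>m n - ?Q) * ?I) (A *\<^sub>v v)"
      "quad_form ((1\<^sub>m n - ?Q) * ?I) (A *\<^sub>v v) \<le> d * quad_form A v"
      unfolding qf[OF v] using bd[OF v] by (simp_all add: left_diff_distrib)
  qed
qed

text \<open>Positive dimension matters here: it makes the spectrum nonempty, so that its minimum and maximum
  are genuine.\<close>

lemma kappa_le_of_preconditioner_bounds:
  assumes n: "n > 0" and A: "spd n A" and B: "preconditioner_bounds n A B c d" and c: "c > 0" and d: "d \<ge> 0"
  shows "kappa_le (B * A) (d / c)"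
proof -
  have sym: "sym_mat n B" using B by (simp add: preconditioner_bounds_def)
  have T: "B * A \<in> carrier_mat n n" using sym_mat_carrier[OF sym] spd_carrier[OF A] by simp
  note K = preconditioned_pencil(1)[OF A sym]
  note ev = preconditioner_bounds_eigenvalue[OF A B]
  note real_ev = complex_eigenvalue_pencil_real[OF A T K]
  have "spectrum (map_mat complex_of_real (B * A)) \<noteq> {}"
    by (rule spectrum_non_empty[OF _ n]) (use T in auto)
  then have ne: "spectrum (B * A) \<noteq> {}" using real_ev(2) by (auto simp: spectrum_def)
  have fin: "finite (spectrum (B * A))" using T by (rule card_finite_spectrum)
  have "lambda_max (B * A) \<le> d"
    unfolding lambda_max_def using fin ne ev by (simp add: spectrum_def)
  also have "d = d / c * c" using c by simp
  also have "\<dots> \<le> d / c * lambda_min (B * A)"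
    unfolding lambda_min_def using fin ne ev c d by (intro mult_left_mono) (auto simp: spectrum_def)
  finally show ?thesis
    unfolding kappa_le_def using real_ev ev c by force
qed

lemma preconditioner_bounds_of_extreme_eigenvalues:
  assumes A: "spd n A" and B: "sym_mat n B"
    and min: "c \<le> lambda_min (B * A)" and max: "lambda_max (B * A) \<le> d"
  shows "preconditioner_bounds n A B c d"
proof -
  have T: "B * A \<in> carrier_mat n n" using sym_mat_carrier[OF B] spd_carrier[OF A] by simp
  note K = preconditioned_pencil[OF A B]
  have fin: "finite (spectrum (B * A))" using T by (rule card_finite_spectrum)
  have "\<forall>s. eigenvalue (B * A) s \<longrightarrow> c \<le> s \<and> s \<le> d"
  proof (intro allI impI)
    fix s assume "eigenvalue (B * A) s"
    then have "s \<in> spectrum (B * A)" by (simp add: spectrum_def)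
    then have "lambda_min (B * A) \<le> s" "s \<le> lambda_max (B * A)"
      unfolding lambda_min_def lambda_max_def using Min_le[OF fin] Max_ge[OF fin] by auto
    with min max show "c \<le> s \<and> s \<le> d" by simp
  qed
  from quad_form_bounds_of_eigenvalues[OF A T K(1) this] B show ?thesis
    by (simp add: preconditioner_bounds_def K(2))
qed

text \<open>Where \<open>x / 2 \<le> \<nu>\<close> the upper bound is monotonicity; beyond \<open>\<nu>\<close> the values stay below the value at
  \<open>\<nu>\<close>, which is itself at most the value at \<open>\<mu> / 2 \<le> \<nu>\<close>.\<close>

lemma ma_poly_scaled_bounds:
  fixes a \<nu> \<mu> :: real
  assumes a: "1/2 \<le> a" "a \<le> 4/3" and nonneg: "poly (ma_poly a k) \<nu> \<ge> 0"
    and dec: "antimono_on {0<..\<nu>} (poly (ma_poly a k))"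
    and top: "\<forall>x \<in> {\<nu>..1}. poly (ma_poly a k) x \<le> poly (ma_poly a k) \<nu>"
    and p: "p = pcompose (ma_poly a k) [:0, 1 / 2:]"
    and \<mu>: "0 < \<mu>" "\<mu> \<le> 2 * \<nu>"
  shows "0 \<le> poly p \<mu>" "\<mu> \<le> x \<Longrightarrow> x \<le> 2 \<Longrightarrow> - 1 \<le> poly p x \<and> poly p x \<le> poly p \<mu>"
proof -
  let ?q = "poly (ma_poly a k)"
  have px: "poly p x = ?q (x / 2)" for x by (simp add: p poly_pcompose)
  have le: "?q y \<le> ?q (\<mu> / 2)" if "\<mu> / 2 \<le> y" "y \<le> \<nu>" for y
    using dec that \<mu> by (auto simp: monotone_on_def)
  have \<nu>\<mu>: "?q \<nu> \<le> ?q (\<mu> / 2)" using le[of \<nu>] \<mu> by simp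
  with nonneg show "0 \<le> poly p \<mu>" by (simp add: px)
  show "- 1 \<le> poly p x \<and> poly p x \<le> poly p \<mu>" if x: "\<mu> \<le> x" "x \<le> 2"
  proof
    show "- 1 \<le> poly p x" using ma_poly_abs_le_1[OF a, of "x / 2" k] x \<mu> by (simp add: px)
    show "poly p x \<le> poly p \<mu>"
    proof (cases "x / 2 \<le> \<nu>")
      case True
      then show ?thesis using le[of "x / 2"] x by (simp add: px)
    next
      case False
      then have "?q (x / 2) \<le> ?q \<nu>" using top x by auto
      with \<nu>\<mu> show ?thesis by (simp add: px)
    qed
  qed
qed

theorem corollary4:
  fixes J k :: nat and n :: "nat \<Rightarrow> nat"
    and A M P :: "nat \<Rightarrow> real mat"
    and a \<nu> \<delta> L \<mu> :: real and p :: "real poly"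
  assumes "amli_setting J n A M P"
    and "two_grid_converges J A M P \<delta>"
    and "k \<ge> 4"
    and "1/2 \<le> a" and "a \<le> 4/3"
    and "0 < \<nu>" and "\<nu> < 1"
    and "poly (ma_poly a k) \<nu> \<ge> 0"
    and "antimono_on {0<..\<nu>} (poly (ma_poly a k))"
    and "\<forall>x \<in> {\<nu>..1}. poly (ma_poly a k) x \<le> poly (ma_poly a k) \<nu>"
    and "L = 2"
    and "p = pcompose (ma_poly a k) [:0, 1 / L:]"
    and "0 < \<mu>" and "\<mu> \<le> min (L * \<nu>) (1 - \<delta>)"
    and "\<mu> \<le> (1 - \<delta>) * (1 - poly p \<mu>)"
  shows "\<forall>l \<in> {1..J}. kappa_le (amli_B J A M P p l * A l) (2 / \<mu>)"
proof -
  note set = assms(1)[unfolded amli_setting_def]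
  have \<delta>: "0 \<le> \<delta>" "\<delta> < 1" using assms(2) by (auto simp: two_grid_converges_def)
  have \<mu>: "\<mu> \<le> 2 * \<nu>" "\<mu> \<le> 1 - \<delta>" using assms(11,14) by auto
  have level: "n l > 0" "spd (n l) (A l)" if "1 \<le> l" "l \<le> J" for l using set that by auto
  define c where "c = 1 - poly p \<mu>"
  have pb: "c \<le> 1" "\<forall>x. \<mu> \<le> x \<longrightarrow> x \<le> 2 \<longrightarrow> c \<le> 1 - poly p x \<and> 1 - poly p x \<le> 2"
    using ma_poly_scaled_bounds[OF assms(4,5,8-10) assms(12)[unfolded assms(11)] assms(13) \<mu>(1)]
    by (auto simp: c_def)
  have "\<mu> \<le> (1 - \<delta>) * c" using assms(15) by (simp add: c_def)
  have "0 < (1 - \<delta>) * c" using assms(13) \<open>\<mu> \<le> (1 - \<delta>) * c\<close> by simp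
  \<comment> \<open>the sign of \<open>c\<close> allows the two-grid bound to be multiplied by it\<close>
  then have c0: "0 < c" using \<delta> by (simp add: zero_less_mult_iff)
  have bounds: "preconditioner_bounds (n l) (A l) (amli_B J A M P p l) \<mu> 2"
    if "1 \<le> l" "l \<le> J" for l
    using that
  proof (induction "J - l" arbitrary: l)
    case 0
    have Al: "spd (n l) (A l)" using level 0 by auto
    have "amli_B J A M P p l = mat_inv (A l)" using 0 by (subst amli_B.simps) simp
    then show ?case using preconditioner_bounds_inverse[OF Al] \<mu> \<delta> by simp
  next
    case (Suc r)
    let ?l' = "Suc l"
    have l: "l \<in> {1..J - 1}" "l < J" using Suc by auto
    have Al: "spd (n l) (A l)" and Al': "spd (n ?l') (A ?l')" using level Suc.prems l by auto
    have Mc: "M l \<in> carrier_mat (n l) (n l)" and Mi: "invertible_mat (M l)"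
      and ne: "energy_opnorm (A l) (1\<^sub>m (n l) - M l * A l) \<le> 1"
      and Pc: "P l \<in> carrier_mat (n l) (n ?l')" using set l(1) by auto
    let ?C = "amli_B_hat J A M P p ?l'" and ?D = "mat_inv (A ?l')"
    have "preconditioner_bounds (n ?l') (A ?l') ?C c 2"
    proof (cases "?l' < J")
      case True
      have "preconditioner_bounds (n ?l') (A ?l') (amli_B J A M P p ?l') \<mu> 2"
        using Suc l by (intro Suc.hyps) auto
      from preconditioner_bounds_poly_acceleration[OF Al' this pb(2)]
      show ?thesis using True spd_carrier[OF Al'] by (subst amli_B_hat.simps) simp
    next
      case False
      then show ?thesis
        using preconditioner_bounds_inverse[OF Al'] pb(1) by (subst amli_B_hat.simps) simp
    qed
    then have C: "sym_mat (n ?l') ?C" and CD: "v \<in> carrier_vec (n ?l') \<Longrightarrow>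
        c * quad_form (A ?l') v \<le> quad_form ?C (A ?l' *\<^sub>v v) \<and> quad_form ?C (A ?l' *\<^sub>v v) \<le> 2 * quad_form (A ?l') v" for v
      by (auto simp: preconditioner_bounds_def)
    have D: "?D \<in> carrier_mat (n ?l') (n ?l')" by (rule spd_inverse(1)[OF Al'])
    have le: "\<forall>y\<in>carrier_vec (n ?l'). c * quad_form ?D y \<le> quad_form ?C y \<and> quad_form ?C y \<le> 2 * quad_form ?D y"
    proof
      fix y :: "real vec" assume y: "y \<in> carrier_vec (n ?l')"
      have v: "?D *\<^sub>v y \<in> carrier_vec (n ?l')" using D y by simp
      show "c * quad_form ?D y \<le> quad_form ?C y \<and> quad_form ?C y \<le> 2 * quad_form ?D y"
        using CD[OF v] quad_form_inverse[OF Al' v] unfolding spd_inverse_mult_vec(2)[OF Al' y] by simp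
    qed
    let ?B = "amli_B J A M P p l"
    have B: "?B = two_level_op (A l) (M l) (P l) ?C" using l(2) by (subst amli_B.simps) simp
    have TG: "two_grid_B A M P l = two_level_op (A l) (M l) (P l) ?D" by (simp add: two_grid_B_def)
    have "sym_mat (n l) (two_grid_B A M P l)"
      unfolding TG by (rule sym_mat_two_level_op[OF Al Mc Mi Pc spd_sym_mat_inverse[OF Al']])
    then have TGb: "preconditioner_bounds (n l) (A l) (two_grid_B A M P l) (1 - \<delta>) 1"
      using assms(2) l(1) by (intro preconditioner_bounds_of_extreme_eigenvalues[OF Al])
        (auto simp: two_grid_converges_def)
    have "\<mu> * quad_form (A l) v \<le> quad_form ?B (A l *\<^sub>v v) \<and> quad_form ?B (A l *\<^sub>v v) \<le> 2 * quad_form (A l) v"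
      if v: "v \<in> carrier_vec (n l)" for v
    proof -
      have w: "A l *\<^sub>v v \<in> carrier_vec (n l)" using spd_carrier[OF Al] v by simp
      let ?g = "quad_form (two_grid_B A M P l) (A l *\<^sub>v v)"
      have g: "(1 - \<delta>) * quad_form (A l) v \<le> ?g" "?g \<le> quad_form (A l) v"
        using TGb v by (auto simp: preconditioner_bounds_def)
      have cmp: "c * ?g \<le> quad_form ?B (A l *\<^sub>v v)" "quad_form ?B (A l *\<^sub>v v) \<le> 2 * ?g"
        unfolding B TG
        using two_level_op_compare[OF Al Mc Mi Pc ne sym_mat_carrier[OF C] D le pb(1) _ w] by auto
      have "\<mu> * quad_form (A l) v \<le> (1 - \<delta>) * c * quad_form (A l) v"
        using \<open>\<mu> \<le> (1 - \<delta>) * c\<close> spd_quad_form_nonneg[OF Al v] by (rule mult_right_mono)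
      also have "\<dots> \<le> c * ?g" using mult_left_mono[OF g(1), of c] c0 by (simp add: ac_simps)
      finally show ?thesis using cmp g by simp
    qed
    moreover have "sym_mat (n l) ?B" unfolding B by (rule sym_mat_two_level_op[OF Al Mc Mi Pc C])
    ultimately show ?case by (simp add: preconditioner_bounds_def)
  qed
  show ?thesis
  proof
    fix l assume "l \<in> {1..J}"
    then have "n l > 0" "spd (n l) (A l)" "1 \<le> l" "l \<le> J" using level by auto
    then show "kappa_le (amli_B J A M P p l * A l) (2 / \<mu>)"
      using assms(13) by (intro kappa_le_of_preconditioner_bounds[OF _ _ bounds]) auto
  qed
qed

end
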